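(* Let $\alpha,\gamma,\rho,a\in\mathbb{C}$ with $\operatorname{Re}(\alpha)>0$ and $a\ne0$, and let $\mu$ be a real number, such that $\mu>0$ and $\operatorname{Re}(\rho)>\max\{0,\operatorname{Re}(-\alpha-\gamma)\}$. Then the left-sided Erdélyi–Kober fractional derivative $\mathcal{D}_{\gamma,\alpha}^{+}=\mathcal{D}_{0+}^{\alpha,0,\gamma}$ satisfies, for every $x>0$, $$\left(\mathcal{D}_{\gamma,\alpha}^{+}\left(t^{\rho-1}I^{m,n}_{p,q}\left[at^{\mu}\,\middle|\begin{matrix}(a_i,A_i,\alpha_i)_{1,p}\\(b_j,B_j,\beta_j)_{1,q}\end{matrix}\right]\right)\right)(x)=x^{\rho-1}\,I^{m,n+1}_{p+1,q+1}\left[ax^{\mu}\,\middle|\begin{matrix}(1-\alpha-\gamma-\rho,\mu,1),\ (a_i,A_i,\alpha_i)_{1,p}\\(b_j,B_j,\beta_j)_{1,q},\ (1-\gamma-\rho,\mu,1)\end{matrix}\right].$$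
   Context: **$I$-function.** Let $m,n,p,q$ be integers with $0\le m\le q$, $0\le n\le p$; let $a_i\in\mathbb{C}$, $A_i,\alpha_i>0$ $(1\le i\le p)$ and $b_j\in\mathbb{C}$, $B_j,\beta_j>0$ $(1\le j\le q)$. For $z\neq0$ (with a chosen value of $\arg z$; $z^{-s}=e^{-s(\log|z|+i\arg z)}$), $$I^{m,n}_{p,q}\left[z\,\middle|\begin{matrix}(a_i,A_i,\alpha_i)_{1,p}\\(b_j,B_j,\beta_j)_{1,q}\end{matrix}\right]=\frac{1}{2\pi i}\int_{C}\chi(s)z^{-s}\,ds,\qquad \chi(s)=\frac{\prod_{j=1}^{m}\Gamma^{\beta_j}(b_j+B_js)\prod_{i=1}^{n}\Gamma^{\alpha_i}(1-a_i-A_is)}{\prod_{j=m+1}^{q}\Gamma^{\beta_j}(1-b_j-B_js)\prod_{i=n+1}^{p}\Gamma^{\alpha_i}(a_i+A_is)}.$$ Here $(a_i,A_i,\alpha_i)_{1,p}$ is the ordered list of triples for $i=1,\dots,p$ (the first $n$ upper triples and the first $m$ lower triples enter the numerator), $\Gamma^{\kappa}(w)=(\Gamma(w))^{\kappa}$, with the branch of non-integer powers fixed along $C$ and the same for the same triple in all $I$-functions considered; empty products equal $1$. The singularities of $\Gamma^{\beta_j}(b_j+B_js)$, $j\le m$, lie to the left of $C$ and those of $\Gamma^{\alpha_i}(1-a_i-A_is)$, $i\le n$, to the right. **Standing assumptions.** The contour $C$ is the imaginary axis $\operatorname{Re}(s)=0$, traversed upwards, and for each $I$-function occurring the following conditions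 for absolute convergence hold: with (computed from the parameters of that $I$-function) $\mu^*=\sum_{j=1}^q\beta_jB_j-\sum_{i=1}^p\alpha_iA_i$, $\Omega=\sum_{i=1}^p(\frac12-\operatorname{Re}(a_i))\alpha_i-\sum_{j=1}^q(\frac12-\operatorname{Re}(b_j))\beta_j$, $\Delta=\sum_{j=1}^m\beta_jB_j-\sum_{j=m+1}^q\beta_jB_j+\sum_{i=1}^n\alpha_iA_i-\sum_{i=n+1}^p\alpha_iA_i$, either $\Delta>0$ and $|\arg z|<\frac{\pi}{2}\Delta$, or $\Delta\ge0$, $|\arg z|=\frac{\pi}{2}\Delta$ and one of: $\mu^*=0$ and $\Omega<-1$; or $\mu^*\ne0$ and $\Omega+\sigma\mu^*<-1$ where $\sigma=\operatorname{Re}(s)$ on $C$ (so $\sigma=0$). For $t>0$, $\arg(at^{\pm\mu})=\arg a$. **Operators.** For $\operatorname{Re}(\alpha)>0$, $x>0$, the left-sided Saigo fractional integral is $$\left(\mathcal{I}_{0+}^{\alpha,\beta,\gamma}f\right)(x)=\frac{x^{-\alpha-\beta}}{\Gamma(\alpha)}\int_0^x(x-t)^{\alpha-1}{}_{2}F_1\left(\alpha+\beta,-\gamma;\alpha;1-\tfrac{t}{x}\right)f(t)\,dt,$$ the left-sided Saigo fractional derivative is $$\left(\mathcal{D}_{0+}^{\alpha,\beta,\gamma}f\right)(x)=\left(\frac{d}{dx}\right)^{N}\left(\mathcal{I}_{0+}^{-\alpha+N,-\beta-N,\alpha+\gamma-N}f\right)(x),\qquad N=[\operatorname{Re}(\alpha)]+1,$$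 with $[\cdot]$ the integer part, and $\mathcal{D}_{\gamma,\alpha}^{+}:=\mathcal{D}_{0+}^{\alpha,0,\gamma}$. *)

theory Defs
  imports "HOL-Analysis.Analysis"
begin

section \<open>The I-function\<close>

text \<open>A triple \<open>(c, C, \<kappa>)\<close> stands for \<open>(a\<^sub>i, A\<^sub>i, \<alpha>\<^sub>i)\<close> or \<open>(b\<^sub>j, B\<^sub>j, \<beta>\<^sub>j)\<close>; the numbers
  \<open>p\<close> and \<open>q\<close> are the lengths of the upper and the lower list.\<close>

type_synonym I_triple = "complex \<times> real \<times> real"

definition I_contour :: "complex set" where
  "I_contour = {s. Re s = 0}"

text \<open>A choice of branches for the powers \<open>\<Gamma>\<^sup>\<kappa>\<close> along the contour: \<open>L c d \<kappa>\<close> is a continuous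
  logarithm of \<open>s \<mapsto> \<Gamma>(c + d s)\<close> on the contour with the poles of that function removed. Indexing
  by \<open>(c, d, \<kappa>)\<close> makes the branch depend on the triple only, so that it is shared by all
  I-functions formed with the same \<open>L\<close>.\<close>

definition Gamma_log_branches ::
    "(complex \<Rightarrow> real \<Rightarrow> real \<Rightarrow> complex \<Rightarrow> complex) \<Rightarrow> bool" where
  "Gamma_log_branches L \<longleftrightarrow> (\<forall>c d \<kappa>.
     continuous_on {s \<in> I_contour. c + of_real d * s \<notin> \<int>\<^sub>\<le>\<^sub>0} (L c d \<kappa>) \<and>
     (\<forall>s \<in> I_contour. c + of_real d * s \<notin> \<int>\<^sub>\<le>\<^sub>0 \<longrightarrow>
        exp (L c d \<kappa> s) = Gamma (c + of_real d * s)))"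

lemma Gamma_log_branches_exist: "\<exists>L. Gamma_log_branches L"
proof -
  define P where "P c d l \<longleftrightarrow> continuous_on {s \<in> I_contour. c + of_real d * s \<notin> \<int>\<^sub>\<le>\<^sub>0} l \<and>
     (\<forall>s \<in> I_contour. c + of_real d * s \<notin> \<int>\<^sub>\<le>\<^sub>0 \<longrightarrow> exp (l s) = Gamma (c + of_real d * s))"
    for c :: complex and d :: real and l
  have "\<exists>l. P c d l" for c d
  proof (cases "\<exists>s\<^sub>0 \<in> I_contour. c + of_real d * s\<^sub>0 \<in> \<int>\<^sub>\<le>\<^sub>0")
    case True
    then obtain s\<^sub>0 where s0: "s\<^sub>0 \<in> I_contour" "c + of_real d * s\<^sub>0 \<in> \<int>\<^sub>\<le>\<^sub>0" by blast
    have real: "Im (c + of_real d * s\<^sub>0) = 0"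
      using s0(2) by (metis Im_complex_of_real complex_nonpos_Reals_iff nonpos_Ints_subset_nonpos_Reals subsetD)
    have *: "c + of_real d * s \<notin> \<real>\<^sub>\<le>\<^sub>0" if "s \<in> I_contour" "c + of_real d * s \<notin> \<int>\<^sub>\<le>\<^sub>0" for s
    proof
      assume "c + of_real d * s \<in> \<real>\<^sub>\<le>\<^sub>0"
      then have "Im c + d * Im s = 0" by (simp add: complex_nonpos_Reals_iff)
      moreover have "Im c + d * Im s\<^sub>0 = 0" using real by simp
      ultimately have "d * Im s = d * Im s\<^sub>0" by linarith
      then have "of_real d * s = of_real d * s\<^sub>0"
        using that(1) s0(1) by (simp add: complex_eq_iff I_contour_def)
      then show False using that(2) s0(2) by metis
    qed
    let ?S = "{s \<in> I_contour. c + of_real d * s \<notin> \<int>\<^sub>\<le>\<^sub>0}"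
    have "continuous_on ?S (\<lambda>s. c + of_real d * s)"
      by (intro continuous_intros)
    moreover have "continuous_on ((\<lambda>s. c + of_real d * s) ` ?S) ln_Gamma"
      by (rule continuous_on_ln_Gamma_complex) (use * in blast)
    ultimately have "continuous_on ?S (\<lambda>s. ln_Gamma (c + of_real d * s))"
      using continuous_on_compose by (simp add: o_def)
    moreover have "\<forall>s \<in> I_contour. c + of_real d * s \<notin> \<int>\<^sub>\<le>\<^sub>0 \<longrightarrow>
        exp (ln_Gamma (c + of_real d * s)) = Gamma (c + of_real d * s)"
      by (simp add: Gamma_complex_altdef)
    ultimately show ?thesis unfolding P_def by blast
  next
    case False
    have "convex I_contour"
      by (auto simp: convex_def I_contour_def)
    moreover have "continuous_on I_contour (\<lambda>s. Gamma (c + of_real d * s))"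
    proof -
      have "continuous_on I_contour (\<lambda>s. c + of_real d * s)"
        by (intro continuous_intros)
      moreover have "continuous_on ((\<lambda>s. c + of_real d * s) ` I_contour) Gamma"
        by (rule continuous_on_Gamma) (use False in blast)
      ultimately show ?thesis
        using continuous_on_compose by (simp add: o_def)
    qed
    moreover have "Gamma (c + of_real d * s) \<noteq> 0" if "s \<in> I_contour" for s
      using False that by (auto simp: Gamma_eq_zero_iff)
    ultimately obtain l where l: "continuous_on I_contour l"
        "\<And>s. s \<in> I_contour \<Longrightarrow> Gamma (c + of_real d * s) = exp (l s)"
      using continuous_logarithm_on_contractible[OF _ convex_imp_contractible,
          of I_contour "\<lambda>s. Gamma (c + of_real d * s)"] by blast
    have "continuous_on {s \<in> I_contour. c + of_real d * s \<notin> \<int>\<^sub>\<le>\<^sub>0} l"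
      by (rule continuous_on_subset[OF l(1)]) blast
    with l(2) show ?thesis unfolding P_def by (intro exI[of _ l]) simp
  qed
  then have "P c d (SOME l. P c d l)" for c d
    by (rule someI_ex)
  then have "Gamma_log_branches (\<lambda>c d \<kappa>. SOME l. P c d l)"
    unfolding Gamma_log_branches_def P_def by blast
  then show ?thesis by blast
qed

text \<open>The factor \<open>\<Gamma>\<^sup>\<kappa>(c + d s)\<close>. At a pole of \<open>\<Gamma>\<close> the value is \<open>0\<close>; such points lie on the
  contour only for factors of the denominator of \<open>\<chi>\<close>, and since \<open>x / 0 = 0\<close> the quotient then
  is \<open>0\<close>, the correct value of \<open>1/\<Gamma>\<^sup>\<kappa>\<close>.\<close>

definition Gamma_pow ::
    "(complex \<Rightarrow> real \<Rightarrow> real \<Rightarrow> complex \<Rightarrow> complex) \<Rightarrow> complex \<Rightarrow> real \<Rightarrow> real \<Rightarrow> complex \<Rightarrow> complex" where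
  "Gamma_pow L c d \<kappa> s =
     (if c + of_real d * s \<in> \<int>\<^sub>\<le>\<^sub>0 then 0 else exp (of_real \<kappa> * L c d \<kappa> s))"

definition I_chi ::
    "(complex \<Rightarrow> real \<Rightarrow> real \<Rightarrow> complex \<Rightarrow> complex) \<Rightarrow> nat \<Rightarrow> nat \<Rightarrow> I_triple list \<Rightarrow> I_triple list
      \<Rightarrow> complex \<Rightarrow> complex" where
  "I_chi L m n up lo s =
     ((\<Prod>(b, B, \<kappa>)\<leftarrow>take m lo. Gamma_pow L b B \<kappa> s) *
      (\<Prod>(a, A, \<kappa>)\<leftarrow>take n up. Gamma_pow L (1 - a) (- A) \<kappa> s)) /
     ((\<Prod>(b, B, \<kappa>)\<leftarrow>drop m lo. Gamma_pow L (1 - b) (- B) \<kappa> s) *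
      (\<Prod>(a, A, \<kappa>)\<leftarrow>drop n up. Gamma_pow L a A \<kappa> s))"

text \<open>The I-function at \<open>z \<noteq> 0\<close> with chosen argument \<open>\<theta>\<close> (not necessarily the principal one).
  The contour is parametrised by \<open>s = \<i> \<tau>\<close>, so \<open>ds = \<i> d\<tau>\<close>.\<close>

definition I_fun ::
    "(complex \<Rightarrow> real \<Rightarrow> real \<Rightarrow> complex \<Rightarrow> complex) \<Rightarrow> nat \<Rightarrow> nat \<Rightarrow> I_triple list \<Rightarrow> I_triple list
      \<Rightarrow> real \<Rightarrow> complex \<Rightarrow> complex" where
  "I_fun L m n up lo \<theta> z =
     1 / (2 * of_real pi * \<i>) *
     (CLBINT \<tau>. I_chi L m n up lo (\<i> * of_real \<tau>) *
        exp (- (\<i> * of_real \<tau>) * (of_real (ln (norm z)) + \<i> * of_real \<theta>)) * \<i>)"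

definition I_mu :: "I_triple list \<Rightarrow> I_triple list \<Rightarrow> real" where
  "I_mu up lo = (\<Sum>(b, B, \<kappa>)\<leftarrow>lo. \<kappa> * B) - (\<Sum>(a, A, \<kappa>)\<leftarrow>up. \<kappa> * A)"

definition I_Omega :: "I_triple list \<Rightarrow> I_triple list \<Rightarrow> real" where
  "I_Omega up lo = (\<Sum>(a, A, \<kappa>)\<leftarrow>up. (1/2 - Re a) * \<kappa>) - (\<Sum>(b, B, \<kappa>)\<leftarrow>lo. (1/2 - Re b) * \<kappa>)"

definition I_Delta :: "nat \<Rightarrow> nat \<Rightarrow> I_triple list \<Rightarrow> I_triple list \<Rightarrow> real" where
  "I_Delta m n up lo =
     (\<Sum>(b, B, \<kappa>)\<leftarrow>take m lo. \<kappa> * B) - (\<Sum>(b, B, \<kappa>)\<leftarrow>drop m lo. \<kappa> * B) +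
     (\<Sum>(a, A, \<kappa>)\<leftarrow>take n up. \<kappa> * A) - (\<Sum>(a, A, \<kappa>)\<leftarrow>drop n up. \<kappa> * A)"

text \<open>The singularities of \<open>\<Gamma>\<^sup>\<kappa>(b + B s)\<close> lie to the left and those of \<open>\<Gamma>\<^sup>\<kappa>(1 - a - A s)\<close> to the
  right of the contour.\<close>

definition I_separated :: "nat \<Rightarrow> nat \<Rightarrow> I_triple list \<Rightarrow> I_triple list \<Rightarrow> bool" where
  "I_separated m n up lo \<longleftrightarrow>
     (\<forall>(b, B, \<kappa>) \<in> set (take m lo). \<forall>s. b + of_real B * s \<in> \<int>\<^sub>\<le>\<^sub>0 \<longrightarrow> Re s < 0) \<and>
     (\<forall>(a, A, \<kappa>) \<in> set (take n up). \<forall>s. 1 - a - of_real A * s \<in> \<int>\<^sub>\<le>\<^sub>0 \<longrightarrow> Re s > 0)"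

definition I_convergent :: "nat \<Rightarrow> nat \<Rightarrow> I_triple list \<Rightarrow> I_triple list \<Rightarrow> real \<Rightarrow> bool" where
  "I_convergent m n up lo \<theta> \<longleftrightarrow>
     (I_Delta m n up lo > 0 \<and> \<bar>\<theta>\<bar> < pi / 2 * I_Delta m n up lo) \<or>
     (I_Delta m n up lo \<ge> 0 \<and> \<bar>\<theta>\<bar> = pi / 2 * I_Delta m n up lo \<and>
       ((I_mu up lo = 0 \<and> I_Omega up lo < -1) \<or>
        (I_mu up lo \<noteq> 0 \<and> (\<forall>s \<in> I_contour. I_Omega up lo + Re s * I_mu up lo < -1))))"


section \<open>Saigo and Erdelyi-Kober operators\<close>

text \<open>The Gauss series. It only gives \<open>\<^sub>2F\<^sub>1\<close> for \<open>\<bar>z\<bar> < 1\<close>, which suffices here: its argument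
  \<open>1 - t / x\<close> lies in \<open>(0, 1)\<close>.\<close>

definition hyp2F1 :: "complex \<Rightarrow> complex \<Rightarrow> complex \<Rightarrow> complex \<Rightarrow> complex" where
  "hyp2F1 a b c z = eval_fps (fps_hypergeo [a, b] [c] 1) z"

definition saigo_integrand ::
    "complex \<Rightarrow> complex \<Rightarrow> complex \<Rightarrow> (real \<Rightarrow> complex) \<Rightarrow> real \<Rightarrow> real \<Rightarrow> complex" where
  "saigo_integrand \<alpha> \<beta> \<gamma> f x t =
     of_real (x - t) powr (\<alpha> - 1) * hyp2F1 (\<alpha> + \<beta>) (- \<gamma>) \<alpha> (of_real (1 - t / x)) * f t"

definition saigo_integral ::
    "complex \<Rightarrow> complex \<Rightarrow> complex \<Rightarrow> (real \<Rightarrow> complex) \<Rightarrow> real \<Rightarrow> complex" where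
  "saigo_integral \<alpha> \<beta> \<gamma> f x =
     of_real x powr (- \<alpha> - \<beta>) / Gamma \<alpha> * (LINT t:{0<..<x}|lborel. saigo_integrand \<alpha> \<beta> \<gamma> f x t)"

definition vderiv :: "(real \<Rightarrow> complex) \<Rightarrow> real \<Rightarrow> complex" where
  "vderiv g x = vector_derivative g (at x)"

definition saigo_order :: "complex \<Rightarrow> nat" where
  "saigo_order \<alpha> = nat (\<lfloor>Re \<alpha>\<rfloor> + 1)"

definition saigo_derivative ::
    "complex \<Rightarrow> complex \<Rightarrow> complex \<Rightarrow> (real \<Rightarrow> complex) \<Rightarrow> real \<Rightarrow> complex" where
  "saigo_derivative \<alpha> \<beta> \<gamma> f =
     (let N = saigo_order \<alpha> in
      (vderiv ^^ N) (saigo_integral (- \<alpha> + of_nat N) (- \<beta> - of_nat N) (\<alpha> + \<gamma> - of_nat N) f))"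

text \<open>\<open>vector_derivative\<close> and the Lebesgue integral are total, so the existence of the Saigo
  derivative on the positive half-line has to be expressed separately.\<close>

definition saigo_derivative_exists ::
    "complex \<Rightarrow> complex \<Rightarrow> complex \<Rightarrow> (real \<Rightarrow> complex) \<Rightarrow> bool" where
  "saigo_derivative_exists \<alpha> \<beta> \<gamma> f \<longleftrightarrow>
     (let N = saigo_order \<alpha>; \<alpha>' = - \<alpha> + of_nat N; \<beta>' = - \<beta> - of_nat N; \<gamma>' = \<alpha> + \<gamma> - of_nat N in
      (\<forall>x>0. set_integrable lborel {0<..<x} (saigo_integrand \<alpha>' \<beta>' \<gamma>' f x)) \<and>
      (\<forall>k<N. \<forall>x>0. (vderiv ^^ k) (saigo_integral \<alpha>' \<beta>' \<gamma>' f) differentiable (at x)))"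

definition erdelyi_kober_derivative ::
    "complex \<Rightarrow> complex \<Rightarrow> (real \<Rightarrow> complex) \<Rightarrow> real \<Rightarrow> complex" where
  "erdelyi_kober_derivative \<gamma> \<alpha> = saigo_derivative \<alpha> 0 \<gamma>"

end

theory Submission
  imports Defs "HOL-Real_Asymp.Real_Asymp"
begin

text \<open>
  Put \<open>s = \<i>\<tau>\<close> and \<open>\<sigma> = \<rho> - \<mu>s\<close>. On the contour the function \<open>f\<close> is a superposition of the powers
  \<open>t\<^bsup>\<sigma>-1\<^esup>\<close>, all with \<open>Re \<sigma> = Re \<rho>\<close>, and the Erdelyi-Kober derivative acts on each of these powers
  by the factor \<open>\<Gamma>(\<sigma>+\<alpha>+\<gamma>) / \<Gamma>(\<sigma>+\<gamma>)\<close>. That factor is exactly the quotient of the integrands of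
  the two I-functions in the claim: the new upper triple supplies \<open>\<Gamma>(\<sigma>+\<alpha>+\<gamma>)\<close> and the new lower
  triple \<open>1/\<Gamma>(\<sigma>+\<gamma>)\<close> (\<open>I_chi_extend\<close>), and both powers have exponent \<open>1\<close>, so that the choice of
  branches is irrelevant to them. It remains to justify that the operator may be applied under the
  contour integral, and to compute its action on a power.

  \<^item> Action on a power. With \<open>N = [Re \<alpha>] + 1\<close>, the integral operator inside the derivative maps
    \<open>t\<^bsup>\<sigma>-1\<^esup>\<close> to a Gamma quotient times \<open>x\<^bsup>\<sigma>+N-1\<^esup>\<close>. This is an Euler integral over a Gauss series
    (\<open>hyp2F1_Beta_integral\<close>); integrating termwise turns it into a Gauss series at \<open>1\<close>, which
    \<open>Gauss_summation\<close> evaluates. That series converges because \<open>Re \<rho> > Re (-\<alpha>-\<gamma>)\<close>, and the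
    terms are integrable at \<open>t = 0\<close> because \<open>Re \<rho> > 0\<close>. The complex Beta integral needed on the
    way is itself obtained from Gauss's theorem, by expanding one of its two factors binomially.

  \<^item> Interchange of integrals. A power \<open>t\<^bsup>-\<mu>\<i>\<tau>\<^esup>\<close> has modulus \<open>1\<close>, so the double integral is dominated
    by a product of a function of \<open>t\<close> and a function of \<open>\<tau>\<close>. Fubini's theorem therefore needs only
    that the kernel times \<open>t\<^bsup>\<rho>-1\<^esup>\<close> and the integrand of the first I-function are integrable
    (\<open>Fubini_Mellin\<close>).

  \<^item> Differentiation. What has to be differentiated \<open>N\<close> times is the integral of
    \<open>V(\<tau>) x\<^bsup>\<sigma>+N-1\<^esup> / (\<sigma>)\<^sub>N\<close>, where \<open>V\<close> is the integrand of the second I-function. Each derivative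
    removes one factor of the rising factorial \<open>(\<sigma>)\<^sub>N\<close>, whose modulus is bounded below by
    \<open>(Re \<rho>)\<^sub>N\<close>; hence all the derivatives are dominated by \<open>|V|\<close>, which is integrable
    (\<open>Mellin_primitive_deriv\<close>).

  \<^item> Integrability. The convergence conditions give integrability through the growth of \<open>\<Gamma>\<close> on
    vertical lines, \<open>|\<Gamma>(x+\<i>t)| \<asymp> |t|\<^bsup>x-1/2\<^esup> e\<^bsup>-\<pi>|t|/2\<^esup>\<close> (\<open>norm_Gamma_vertical_bigtheta\<close>). Only this
    order of magnitude is needed, and it has a short proof by convexity: for fixed \<open>t\<close> the function
    \<open>x \<mapsto> ln (\<Gamma>(x) / |\<Gamma>(x+\<i>t)|)\<close> is convex, since it is the sum over \<open>k\<close> of the values at \<open>x+k\<close> of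
    a convex function, it is known at \<open>x = 1/2\<close> by the reflection formula, and its increments over
    unit steps are known by the functional equation.
\<close>

section \<open>Complex powers of positive reals\<close>

text \<open>For \<open>x > 0\<close> this is \<open>of_real x powr s\<close>. With the real logarithm there is no branch cut,
  and measurability in both arguments is immediate.\<close>

definition cpow :: "real \<Rightarrow> complex \<Rightarrow> complex" where
  "cpow x s = exp (s * of_real (ln x))"

lemma cpow_eq_powr: "x > 0 \<Longrightarrow> of_real x powr s = cpow x s"
  by (simp add: cpow_def powr_def Ln_of_real)

lemma norm_cpow: "x > 0 \<Longrightarrow> norm (cpow x s) = x powr Re s"
  by (simp add: cpow_def powr_def)

lemma cpow_add: "cpow x (s + t) = cpow x s * cpow x t"
  by (simp add: cpow_def exp_add distrib_right)

lemma cpow_mult: "x > 0 \<Longrightarrow> y > 0 \<Longrightarrow> cpow (x * y) s = cpow x s * cpow y s"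
  by (simp add: cpow_def exp_add distrib_left ln_mult)

lemma cpow_of_nat: "x > 0 \<Longrightarrow> cpow x (of_nat n) = of_real x ^ n"
proof -
  assume "x > 0"
  then have "exp (complex_of_real (ln x)) = of_real x"
    by (metis exp_ln exp_of_real)
  then show ?thesis by (simp add: cpow_def exp_of_nat_mult)
qed

lemma cpow_measurable [measurable]:
  assumes [measurable]: "f \<in> borel_measurable M" "g \<in> borel_measurable M"
  shows "(\<lambda>x. cpow (f x) (g x)) \<in> borel_measurable M"
  unfolding cpow_def by measurable

lemma has_vector_derivative_cpow:
  assumes "x > 0"
  shows "((\<lambda>x. cpow x s) has_vector_derivative s * cpow x (s - 1)) (at x)"
proof -
  have "((\<lambda>x. s * complex_of_real (ln x)) has_vector_derivative s * of_real (1 / x)) (at x)"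
    using assms
    by (intro has_vector_derivative_mult_right has_vector_derivative_of_real)
       (auto intro!: derivative_eq_intros simp: has_real_derivative_iff_has_vector_derivative[symmetric])
  from field_vector_diff_chain_at[OF this, of exp "exp (s * of_real (ln x))"]
  have "((\<lambda>x. cpow x s) has_vector_derivative (s * of_real (1/x)) * cpow x s) (at x)"
    by (simp add: o_def cpow_def)
  moreover have "cpow x (s - 1) = of_real (1/x) * cpow x s"
    using assms by (simp add: cpow_def left_diff_distrib exp_diff exp_of_real)
  ultimately show ?thesis by (simp add: mult_ac)
qed

section \<open>Gauss's summation theorem\<close>

text \<open>Euler's limit formula says that \<open>(a)\<^sub>n\<^sub>+\<^sub>1 / (n! n\<^sup>a)\<close> converges to \<open>1/\<Gamma>(a)\<close>, hence is bounded; away from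
  the poles the reciprocal is bounded as well. The power of \<open>n\<close> is written with \<open>exp\<close> and \<open>ln\<close>
  so that the bounds also hold at \<open>n = 0\<close>.\<close>

lemma norm_pochhammer_upper:
  obtains K where "K > 0" "\<And>n. norm (pochhammer (a::complex) (Suc n)) \<le> K * (fact n * exp (Re a * ln (real n)))"
proof -
  have "Bseq (rGamma_series a)"
    using rGamma_series_LIMSEQ[of a] by (intro convergent_imp_Bseq) (auto simp: convergent_def)
  then obtain K where K: "K > 0" "\<And>n. norm (rGamma_series a n) \<le> K" by (auto elim: BseqE)
  show ?thesis
  proof (rule that[OF K(1)])
    fix n
    show "norm (pochhammer a (Suc n)) \<le> K * (fact n * exp (Re a * ln (real n)))"
      using K(2)[of n] by (simp add: rGamma_series_def norm_divide norm_mult divide_le_eq)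
  qed
qed

lemma norm_pochhammer_lower:
  assumes "(a::complex) \<notin> \<int>\<^sub>\<le>\<^sub>0"
  obtains K where "K > 0" "\<And>n. fact n * exp (Re a * ln (real n)) \<le> K * norm (pochhammer a (Suc n))"
proof -
  have "Bseq (Gamma_series a)"
    using Gamma_series_LIMSEQ[of a] by (intro convergent_imp_Bseq) (auto simp: convergent_def)
  then obtain K where K: "K > 0" "\<And>n. norm (Gamma_series a n) \<le> K" by (auto elim: BseqE)
  have nz: "pochhammer a k \<noteq> 0" for k
    using assms by (auto simp: pochhammer_eq_0_iff)
  show ?thesis
  proof (rule that[OF K(1)])
    fix n
    show "fact n * exp (Re a * ln (real n)) \<le> K * norm (pochhammer a (Suc n))"
      using K(2)[of n] nz[of "Suc n"] by (simp add: Gamma_series_def norm_divide norm_mult divide_le_eq del: pochhammer_Suc)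
  qed
qed

definition hyp_coeff :: "complex \<Rightarrow> complex \<Rightarrow> complex \<Rightarrow> nat \<Rightarrow> complex" where
  "hyp_coeff a b c k = pochhammer a k * pochhammer b k / (pochhammer c k * fact k)"

lemma hyp_coeff_bound:
  assumes "c \<notin> \<int>\<^sub>\<le>\<^sub>0"
  obtains K where "K > 0"
    "\<And>n. norm (hyp_coeff a b c (Suc n)) \<le> K * (exp (- Re (c - a - b) * ln (real n)) / Suc n)"
proof -
  from norm_pochhammer_upper[of a] obtain A where A: "A > 0" "\<And>n. norm (pochhammer a (Suc n)) \<le> A * (fact n * exp (Re a * ln (real n)))" by metis
  from norm_pochhammer_upper[of b] obtain B where B: "B > 0" "\<And>n. norm (pochhammer b (Suc n)) \<le> B * (fact n * exp (Re b * ln (real n)))" by metis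
  from norm_pochhammer_lower[OF assms] obtain C where C: "C > 0" "\<And>n. fact n * exp (Re c * ln (real n)) \<le> C * norm (pochhammer c (Suc n))" by metis
  show ?thesis
  proof (rule that[of "A * B * C"])
    show "A * B * C > 0" using A(1) B(1) C(1) by simp
    fix n
    have nz: "pochhammer c (Suc n) \<noteq> 0"
      using assms by (auto simp: pochhammer_eq_0_iff)
    have "norm (hyp_coeff a b c (Suc n)) =
      norm (pochhammer a (Suc n)) * norm (pochhammer b (Suc n)) / (norm (pochhammer c (Suc n)) * fact (Suc n))"
      unfolding hyp_coeff_def by (simp add: norm_mult norm_divide del: pochhammer_Suc fact_Suc)
    also have "\<dots> \<le> (A * (fact n * exp (Re a * ln (real n)))) * (B * (fact n * exp (Re b * ln (real n)))) /
        ((fact n * exp (Re c * ln (real n)) / C) * fact (Suc n))"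
      using A B C nz
      by (intro frac_le mult_mono mult_pos_pos) (auto simp: field_simps simp del: pochhammer_Suc fact_Suc)
    also have "\<dots> = A * B * C * (exp (- Re (c - a - b) * ln (real n)) / Suc n)"
      using A(1) B(1) C(1) by (simp add: divide_simps exp_diff exp_add exp_minus) (simp add: algebra_simps flip: exp_add)
    finally show "norm (hyp_coeff a b c (Suc n)) \<le> \<dots>" .
  qed
qed

lemma summable_hyp_coeff:
  assumes "c \<notin> \<int>\<^sub>\<le>\<^sub>0" "Re (c - a - b) > 0"
  shows "summable (\<lambda>k. norm (hyp_coeff a b c k))"
proof -
  define d where "d = Re (c - a - b)"
  have d: "d > 0" using assms(2) by (simp add: d_def)
  obtain K where K: "K > 0"
    "\<And>n. norm (hyp_coeff a b c (Suc n)) \<le> K * (exp (- d * ln (real n)) / Suc n)"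
    using hyp_coeff_bound[OF assms(1)] d_def by metis
  have "summable (\<lambda>n. norm (hyp_coeff a b c (Suc n)))"
  proof (rule summable_comparison_test_ev)
    show "summable (\<lambda>n. K * real n powr (- d - 1))"
      using d by (intro summable_mult) (simp add: summable_real_powr_iff)
    show "\<forall>\<^sub>F n in sequentially. norm (norm (hyp_coeff a b c (Suc n))) \<le> K * real n powr (- d - 1)"
      using eventually_gt_at_top[of 0]
    proof eventually_elim
      case (elim n)
      have "exp (- d * ln (real n)) / Suc n \<le> exp (- d * ln (real n)) / n"
        using elim by (intro divide_left_mono) auto
      also have "\<dots> = real n powr (- d - 1)"
        using elim by (simp add: powr_def left_diff_distrib exp_diff)
      finally have "K * (exp (- d * ln (real n)) / Suc n) \<le> K * real n powr (- d - 1)"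
        using K(1) by (intro mult_left_mono) auto
      then show ?case using K(2)[of n] by simp
    qed
  qed
  then show ?thesis by (subst (asm) summable_Suc_iff)
qed

lemma hyp_coeff_mult_tendsto_0:
  assumes "c \<notin> \<int>\<^sub>\<le>\<^sub>0" "Re (c - a - b) > 0"
  shows "(\<lambda>k. of_nat k * hyp_coeff a b c k) \<longlonglongrightarrow> 0"
proof -
  define d where "d = Re (c - a - b)"
  have d: "d > 0" using assms(2) by (simp add: d_def)
  obtain K where K: "K > 0"
    "\<And>n. norm (hyp_coeff a b c (Suc n)) \<le> K * (exp (- d * ln (real n)) / Suc n)"
    using hyp_coeff_bound[OF assms(1)] d_def by metis
  have "(\<lambda>k. of_nat (Suc k) * hyp_coeff a b c (Suc k)) \<longlonglongrightarrow> 0"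
  proof (rule Lim_null_comparison)
    show "\<forall>\<^sub>F n in sequentially. norm (of_nat (Suc n) * hyp_coeff a b c (Suc n)) \<le> K * exp (- d * ln (real n))"
      using K(2) by (intro always_eventually) (auto simp: norm_mult field_simps simp del: of_nat_Suc)
    show "(\<lambda>n. K * exp (- d * ln (real n))) \<longlonglongrightarrow> 0"
      using d by real_asymp
  qed
  then show ?thesis by (subst (asm) filterlim_sequentially_Suc)
qed

text \<open>The coefficients grow at most polynomially, and a geometric factor beats that.\<close>

lemma hyp_coeff_power_summable:
  fixes v :: real
  assumes "c \<notin> \<int>\<^sub>\<le>\<^sub>0" "0 < v" "v < 1"
  shows "summable (\<lambda>k. norm (hyp_coeff a b c k * of_real v ^ k))"
proof -
  define d where "d = Re (c - a - b)"
  obtain K where K: "K > 0"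
    "\<And>n. norm (hyp_coeff a b c (Suc n)) \<le> K * (exp (- d * ln (real n)) / Suc n)"
    using hyp_coeff_bound[OF assms(1)] d_def by metis
  have "summable (\<lambda>n. norm (hyp_coeff a b c (Suc n) * of_real v ^ Suc n))"
  proof (rule summable_comparison_test_ev)
    show "\<forall>\<^sub>F n in sequentially. norm (norm (hyp_coeff a b c (Suc n) * of_real v ^ Suc n)) \<le> K * (exp (- d * ln (real n)) / Suc n * v ^ Suc n)"
      using K assms(2) mult_right_mono[OF K(2), of "v ^ Suc _"]
      by (intro always_eventually allI) (simp add: norm_mult norm_power mult.assoc del: power_Suc)
    have "(\<lambda>n. exp (- d * ln (real n)) / Suc n * v ^ Suc n) \<in> O(\<lambda>n. 1 / real n ^ 2)"
      using assms(2,3) by real_asymp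
    then have "summable (\<lambda>n. exp (- d * ln (real n)) / Suc n * v ^ Suc n)"
      by (rule summable_comparison_test_bigo[rotated]) (use inverse_power_summable[of 2, where 'a=real] in \<open>simp add: field_simps\<close>)
    then show "summable (\<lambda>n. K * (exp (- d * ln (real n)) / Suc n * v ^ Suc n))"
      by (rule summable_mult)
  qed
  then show ?thesis by (subst (asm) summable_Suc_iff)
qed

text \<open>The termwise difference of the two sides telescopes, with partial sums proportional to
  \<open>k\<close> times the \<open>k\<close>-th coefficient, which tends to \<open>0\<close>.\<close>

lemma Gauss_contiguous:
  assumes "c \<notin> \<int>\<^sub>\<le>\<^sub>0" "Re (c - a - b) > 0"
  shows "(c - a) * (c - b) * (\<Sum>k. hyp_coeff a b (c + 1) k) = c * (c - a - b) * (\<Sum>k. hyp_coeff a b c k)"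
proof -
  have c1: "c + 1 \<notin> \<int>\<^sub>\<le>\<^sub>0" using assms(1) by (meson plus_one_in_nonpos_Ints_imp)
  have nz: "c + of_nat k \<noteq> 0" for k
    using assms(1) by (metis add.commute add.right_neutral add_minus_cancel minus_of_nat_in_nonpos_Ints)
  have s0: "summable (hyp_coeff a b c)" using summable_hyp_coeff[OF assms] by (rule summable_norm_cancel)
  have s1: "summable (hyp_coeff a b (c+1))" using summable_hyp_coeff[OF c1, of a b] assms(2) by (simp add: summable_norm_cancel)
  have tele: "(c - a) * (c - b) * hyp_coeff a b (c + 1) k - c * (c - a - b) * hyp_coeff a b c k =
     c * (of_nat (Suc k) * hyp_coeff a b c (Suc k)) - c * (of_nat k * hyp_coeff a b c k)" for k
  proof -
    have p: "c * pochhammer (c + 1) k = pochhammer c k * (c + of_nat k)"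
      using pochhammer_rec[of c k] pochhammer_Suc[of c k] by simp
    have p0: "pochhammer c k \<noteq> 0" using assms(1) by (auto simp: pochhammer_eq_0_iff)
    have c0: "c \<noteq> 0" using nz[of 0] by simp
    have "pochhammer (c+1) k = pochhammer c k * (c + of_nat k) / c" using p c0 by (simp add: field_simps)
    then have 1: "hyp_coeff a b (c+1) k = hyp_coeff a b c k * c / (c + of_nat k)"
      using p0 c0 nz[of k] by (simp only: hyp_coeff_def) (simp add: divide_simps)
    have 2: "of_nat (Suc k) * hyp_coeff a b c (Suc k) = hyp_coeff a b c k * (a + of_nat k) * (b + of_nat k) / (c + of_nat k)"
      using p0 nz[of k] of_nat_neq_0[of k, where 'a=complex] unfolding hyp_coeff_def pochhammer_Suc fact_Suc
      by (simp add: divide_simps del: of_nat_Suc)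
    have "(c - a) * (c - b) * (hyp_coeff a b c k * c / (c + of_nat k)) - c * (c - a - b) * hyp_coeff a b c k
       = c * (hyp_coeff a b c k * (a + of_nat k) * (b + of_nat k) / (c + of_nat k)) - c * (of_nat k * hyp_coeff a b c k)"
      using nz[of k] by (simp add: divide_simps) (simp add: algebra_simps)
    then show ?thesis unfolding 1 2 .
  qed
  have "(\<lambda>k. c * (of_nat (Suc k) * hyp_coeff a b c (Suc k)) - c * (of_nat k * hyp_coeff a b c k)) sums (c * 0 - c * (of_nat 0 * hyp_coeff a b c 0))"
    by (intro telescope_sums tendsto_mult tendsto_const hyp_coeff_mult_tendsto_0 assms)
  moreover have "(\<lambda>k. (c - a) * (c - b) * hyp_coeff a b (c + 1) k - c * (c - a - b) * hyp_coeff a b c k) sums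
      ((c - a) * (c - b) * (\<Sum>k. hyp_coeff a b (c + 1) k) - c * (c - a - b) * (\<Sum>k. hyp_coeff a b c k))"
    by (intro sums_diff sums_mult summable_sums s0 s1)
  ultimately have "(c - a) * (c - b) * (\<Sum>k. hyp_coeff a b (c + 1) k) - c * (c - a - b) * (\<Sum>k. hyp_coeff a b c k) = 0"
    unfolding tele using sums_unique2 by fastforce
  then show ?thesis by simp
qed

lemma Re_pos_notin_nonpos_Ints: "Re z > 0 \<Longrightarrow> z \<notin> \<int>\<^sub>\<le>\<^sub>0"
  by (auto elim!: nonpos_Ints_cases)

lemma norm_pochhammer_mono:
  assumes "0 \<le> x" "x \<le> Re z"
  shows "pochhammer x k \<le> norm (pochhammer z k)"
proof (induction k)
  case (Suc k)
  have "x + real k \<le> Re (z + of_nat k)" using assms by simp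
  also have "\<dots> \<le> norm (z + of_nat k)" by (rule complex_Re_le_cmod)
  finally show ?case using Suc assms
    unfolding pochhammer_Suc norm_mult by (intro mult_mono) auto
qed simp

text \<open>All terms but the first are small when the lower parameter is large. They are dominated, uniformly
  in the shift, by the terms belonging to the lower parameter \<open>Re c\<close>.\<close>

lemma Gauss_shift_tendsto:
  assumes "Re c > 0" "Re (c - a - b) > 0"
  shows "(\<lambda>n. \<Sum>k. hyp_coeff a b (c + of_nat (Suc n)) k) \<longlonglongrightarrow> 1"
proof -
  have pos: "pochhammer (Re c) k > 0" for k using assms(1) by (rule pochhammer_pos)
  define M where "M k = norm (pochhammer a k * pochhammer b k) / (pochhammer (Re c) k * fact k)" for k
  have bound: "norm (hyp_coeff a b (c + of_nat (Suc n)) k) \<le> M k" for n k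
  proof -
    have "pochhammer (Re c) k \<le> norm (pochhammer (c + of_nat (Suc n)) k)"
      using assms(1) by (intro norm_pochhammer_mono) auto
    then show ?thesis
      unfolding hyp_coeff_def M_def norm_divide norm_mult[of "pochhammer (c + _) k" "fact k"] norm_fact
      using pos[of k] by (intro frac_le mult_right_mono) auto
  qed
  have "M = (\<lambda>k. norm (hyp_coeff a b (of_real (Re c)) k))"
    using pos by (auto simp: fun_eq_iff M_def hyp_coeff_def norm_mult norm_divide pochhammer_of_real abs_of_pos)
  moreover have "summable (\<lambda>k. norm (hyp_coeff a b (of_real (Re c)) k))"
    using assms by (intro summable_hyp_coeff Re_pos_notin_nonpos_Ints) auto
  ultimately have sM: "summable M" by simp
  have lim: "(\<lambda>n. hyp_coeff a b (c + of_nat (Suc n)) k) \<longlonglongrightarrow> (if k = 0 then 1 else 0)" for k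
  proof (cases k)
    case 0
    then show ?thesis by (simp add: hyp_coeff_def)
  next
    case (Suc j)
    define Q where "Q = norm (pochhammer a k * pochhammer b k) / (pochhammer (Re c) j * fact k)"
    have "(\<lambda>n. hyp_coeff a b (c + of_nat (Suc n)) k) \<longlonglongrightarrow> 0"
    proof (rule Lim_null_comparison)
      show "(\<lambda>n. Q / Suc n) \<longlonglongrightarrow> 0" by real_asymp
      show "\<forall>\<^sub>F n in sequentially. norm (hyp_coeff a b (c + of_nat (Suc n)) k) \<le> Q / Suc n"
      proof (intro always_eventually allI)
        fix n
        have "real (Suc n) \<le> Re (c + of_nat (Suc n))" using assms(1) by simp
        also have "\<dots> \<le> norm (c + of_nat (Suc n))" by (rule complex_Re_le_cmod)
        finally have 1: "real (Suc n) \<le> norm (c + of_nat (Suc n))" .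
        have 2: "pochhammer (Re c) j \<le> norm (pochhammer (c + of_nat (Suc n) + 1) j)"
          using assms(1) by (intro norm_pochhammer_mono) auto
        have "real (Suc n) * pochhammer (Re c) j \<le> norm (pochhammer (c + of_nat (Suc n)) k)"
          unfolding Suc pochhammer_rec norm_mult using 1 2 pos[of j] by (intro mult_mono) auto
        then have "norm (hyp_coeff a b (c + of_nat (Suc n)) k) \<le> norm (pochhammer a k * pochhammer b k) / (real (Suc n) * pochhammer (Re c) j * fact k)"
          unfolding hyp_coeff_def norm_divide norm_mult[of "pochhammer (c + _) k" "fact k"] norm_fact
          using pos[of j] by (intro frac_le mult_right_mono) auto
        then show "norm (hyp_coeff a b (c + of_nat (Suc n)) k) \<le> Q / Suc n"
          by (simp add: Q_def field_simps)
      qed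
    qed
    then show ?thesis using Suc by simp
  qed
  have "(\<lambda>n. \<Sum>k. hyp_coeff a b (c + of_nat (Suc n)) k) \<longlonglongrightarrow> (\<Sum>k. if k = 0 then 1 else 0)"
    by (rule tannerys_theorem[where M = M, THEN conjunct2, THEN conjunct2, OF lim _ sM])
       (use bound in \<open>auto intro!: always_eventually\<close>)
  also have "(\<Sum>k. if k = 0 then 1 else 0 :: complex) = 1"
    using sums_If_finite[of "\<lambda>k. k = 0" "\<lambda>_. 1::complex"] by (simp add: sums_iff)
  finally show ?thesis .
qed

text \<open>Iterating the contiguous relation \<open>n+1\<close> times expresses the sum as a quotient of four rising
  factorials times a sum that tends to \<open>1\<close>. In that quotient the powers of \<open>n\<close> and the factorials of
  Euler's formula cancel, so it converges to the stated Gamma quotient. Writing it with \<open>rGamma\<close>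
  covers the case in which \<open>c - a\<close> or \<open>c - b\<close> is a pole of \<open>\<Gamma>\<close>.\<close>

theorem Gauss_summation:
  assumes "Re c > 0" "Re (c - a - b) > 0"
  shows "hyp_coeff a b c sums (Gamma c * Gamma (c - a - b) * rGamma (c - a) * rGamma (c - b))"
proof -
  define S where "S c = (\<Sum>k. hyp_coeff a b c k)" for c
  have c0: "c \<notin> \<int>\<^sub>\<le>\<^sub>0" "c - a - b \<notin> \<int>\<^sub>\<le>\<^sub>0" using assms Re_pos_notin_nonpos_Ints by auto
  have iter: "pochhammer (c - a) n * pochhammer (c - b) n * S (c + of_nat n) =
      pochhammer c n * pochhammer (c - a - b) n * S c" for n
  proof (induction n)
    case (Suc n)
    have "(c + of_nat n - a) * (c + of_nat n - b) * S (c + of_nat n + 1) = (c + of_nat n) * (c + of_nat n - a - b) * S (c + of_nat n)"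
      unfolding S_def using assms by (intro Gauss_contiguous Re_pos_notin_nonpos_Ints) auto
    note e = this
    have "pochhammer (c - a) (Suc n) * pochhammer (c - b) (Suc n) * S (c + of_nat (Suc n))
      = pochhammer (c - a) n * pochhammer (c - b) n * ((c + of_nat n - a) * (c + of_nat n - b) * S (c + of_nat n + 1))"
      by (simp add: pochhammer_Suc algebra_simps)
    also have "\<dots> = (c + of_nat n) * (c + of_nat n - a - b) * (pochhammer (c - a) n * pochhammer (c - b) n * S (c + of_nat n))"
      unfolding e by (simp only: mult_ac)
    also have "\<dots> = pochhammer c (Suc n) * pochhammer (c - a - b) (Suc n) * S c"
      unfolding Suc by (simp add: pochhammer_Suc algebra_simps)
    finally show ?case .
  qed simp
  have "S c = Gamma_series c n * Gamma_series (c - a - b) n * rGamma_series (c - a) n * rGamma_series (c - b) n * S (c + of_nat (Suc n))" for n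
  proof -
    define E where "E z = exp (z * of_real (ln (of_nat n)) :: complex)" for z
    have E: "E c * E (c - a - b) = E (c - a) * E (c - b)" "E z \<noteq> 0" for z
      by (simp_all add: E_def algebra_simps flip: exp_add)
    have nz: "pochhammer c (Suc n) \<noteq> 0" "pochhammer (c - a - b) (Suc n) \<noteq> 0"
      using c0 by (auto simp: pochhammer_eq_0_iff)
    have "S c = pochhammer (c - a) (Suc n) * pochhammer (c - b) (Suc n) / (pochhammer c (Suc n) * pochhammer (c - a - b) (Suc n)) * S (c + of_nat (Suc n))"
      using iter[of "Suc n"] nz by (simp add: field_simps del: pochhammer_Suc of_nat_Suc)
    also have "pochhammer (c - a) (Suc n) * pochhammer (c - b) (Suc n) / (pochhammer c (Suc n) * pochhammer (c - a - b) (Suc n))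
      = (E c * E (c - a - b)) / (E (c - a) * E (c - b)) * (pochhammer (c - a) (Suc n) * pochhammer (c - b) (Suc n) / (pochhammer c (Suc n) * pochhammer (c - a - b) (Suc n)))"
      unfolding E(1) using E(2) by (simp del: pochhammer_Suc)
    also have "\<dots> = Gamma_series c n * Gamma_series (c - a - b) n * rGamma_series (c - a) n * rGamma_series (c - b) n"
      unfolding Gamma_series_def rGamma_series_def E_def[symmetric] Suc_eq_plus1[symmetric]
      using nz E(2) by (simp add: field_simps del: pochhammer_Suc)
    finally show ?thesis .
  qed
  moreover have "(\<lambda>n. Gamma_series c n * Gamma_series (c - a - b) n * rGamma_series (c - a) n * rGamma_series (c - b) n * S (c + of_nat (Suc n)))
      \<longlonglongrightarrow> Gamma c * Gamma (c - a - b) * rGamma (c - a) * rGamma (c - b) * 1"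
    unfolding S_def by (intro tendsto_mult Gamma_series_LIMSEQ rGamma_series_LIMSEQ Gauss_shift_tendsto assms)
  ultimately have "S c = Gamma c * Gamma (c - a - b) * rGamma (c - a) * rGamma (c - b)"
    using LIMSEQ_unique[OF tendsto_const[of "S c"]] by simp
  moreover have "summable (hyp_coeff a b c)"
    using summable_hyp_coeff[OF c0(1) assms(2)] by (rule summable_norm_cancel)
  ultimately show ?thesis by (simp add: S_def sums_iff)
qed

section \<open>Beta integrals against the Gauss series\<close>

lemma Beta_shift_left:
  fixes x y :: "'a :: Gamma"
  assumes "x \<notin> \<int>\<^sub>\<le>\<^sub>0" "x + y \<notin> \<int>\<^sub>\<le>\<^sub>0"
  shows "Beta (x + of_nat k) y = Beta x y * (pochhammer x k / pochhammer (x + y) k)"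
proof (induction k)
  case (Suc k)
  have nz: "x + y + of_nat k \<noteq> 0"
    using assms(2) by (metis add.commute add.right_neutral add_minus_cancel minus_of_nat_in_nonpos_Ints)
  have "x + of_nat k \<notin> \<int>\<^sub>\<le>\<^sub>0"
    using assms(1) by (metis add_diff_cancel_right' nonpos_Ints_diff_Nats of_nat_in_Nats)
  then have "(x + of_nat k + y) * Beta (x + of_nat k + 1) y = (x + of_nat k) * Beta (x + of_nat k) y"
    by (rule Beta_plus1_left)
  then have "Beta (x + of_nat (Suc k)) y = (x + of_nat k) / (x + y + of_nat k) * Beta (x + of_nat k) y"
    using nz by (simp add: field_simps)
  then show ?case by (simp add: Suc pochhammer_Suc mult_ac)
qed simp

lemma Beta_integral_real:
  assumes "a > 0" "b > (0::real)"
  shows "set_integrable lborel {0<..<1} (\<lambda>t. t powr (a - 1) * (1 - t) powr (b - 1))"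
    and "(LINT t:{0<..<1}|lborel. t powr (a - 1) * (1 - t) powr (b - 1)) = Beta a b"
proof -
  show *: "set_integrable lborel {0<..<1} (\<lambda>t. t powr (a - 1) * (1 - t) powr (b - 1))"
    using integrable_Beta[OF assms] by (rule set_integrable_subset) auto
  have "integral {0<..<1} (\<lambda>t. t powr (a - 1) * (1 - t) powr (b - 1)) = Beta a b"
    using has_integral_Beta_real[OF assms] by (simp add: integral_open_interval_real[symmetric] integral_unique)
  then show "(LINT t:{0<..<1}|lborel. t powr (a - 1) * (1 - t) powr (b - 1)) = Beta a b"
    using set_borel_integral_eq_integral(2)[OF *] by simp
qed

lemma Beta_kernel_integrable:
  assumes "Re a > 0" "Re b > 0"
  shows "set_integrable lborel {0<..<1} (\<lambda>t. cpow t (a - 1) * cpow (1 - t) (b - 1))"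
  unfolding set_integrable_def
proof (rule Bochner_Integration.integrable_bound)
  show "integrable lborel (\<lambda>t. indicator {0<..<1} t *\<^sub>R (t powr (Re a - 1) * (1 - t) powr (Re b - 1)))"
    using Beta_integral_real(1)[OF assms] by (simp add: set_integrable_def)
  show "AE t in lborel. norm (indicat_real {0<..<1} t *\<^sub>R (cpow t (a - 1) * cpow (1 - t) (b - 1)))
         \<le> norm (indicat_real {0<..<1} t *\<^sub>R (t powr (Re a - 1) * (1 - t) powr (Re b - 1)))"
    by (intro AE_I2) (auto simp: indicator_def norm_mult norm_cpow)
qed simp

text \<open>The real Beta integral is the \<open>L\<^sup>1\<close> norm of each term, so the hypothesis on \<open>w\<close> is the summability
  of these norms.\<close>

lemma termwise_Beta_integral:
  fixes w :: "nat \<Rightarrow> complex" and g :: "real \<Rightarrow> complex"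
  assumes c: "Re c > 0" and r: "Re r > 0"
    and sums: "\<And>v. 0 < v \<Longrightarrow> v < 1 \<Longrightarrow> (\<lambda>k. w k * of_real v ^ k) sums g v"
    and norm: "\<And>v. 0 < v \<Longrightarrow> v < 1 \<Longrightarrow> summable (\<lambda>k. norm (w k * of_real v ^ k))"
    and summable: "summable (\<lambda>k. norm (w k) * Beta (Re c + real k) (Re r))"
  shows "set_integrable lborel {0<..<1} (\<lambda>v. cpow v (c - 1) * cpow (1 - v) (r - 1) * g v)" (is ?int)
    and "(LINT v:{0<..<1}|lborel. cpow v (c - 1) * cpow (1 - v) (r - 1) * g v) =
      (\<Sum>k. w k * (LINT v:{0<..<1}|lborel. cpow v (c + of_nat k - 1) * cpow (1 - v) (r - 1)))" (is ?eq)
proof -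
  define F where "F k v = indicator {0<..<1} v *\<^sub>R (w k * (cpow v (c + of_nat k - 1) * cpow (1 - v) (r - 1)))" for k v
  have F_alt: "F k v = (if 0 < v \<and> v < 1 then cpow v (c - 1) * cpow (1 - v) (r - 1) * (w k * of_real v ^ k) else 0)" for k v
  proof -
    have "cpow v (c + of_nat k - 1) = cpow v (c - 1) * of_real v ^ k" if "v > 0"
      using cpow_add[of v "c - 1" "of_nat k"] cpow_of_nat[OF that] by (simp add: algebra_simps)
    then show ?thesis by (simp add: F_def indicator_def)
  qed
  have int: "integrable lborel (F k)" for k
    using set_integrable_mult_right[OF Beta_kernel_integrable[of "c + of_nat k" r], of "w k"] c r
    unfolding F_def set_integrable_def by simp
  have LF: "integral\<^sup>L lborel (F k) = w k * (LINT v:{0<..<1}|lborel. cpow v (c + of_nat k - 1) * cpow (1 - v) (r - 1))" for k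
    unfolding F_def set_lebesgue_integral_def
    by (subst integral_mult_right_zero[symmetric]) (simp add: mult.assoc)
  have nF: "(\<integral>v. norm (F k v) \<partial>lborel) = norm (w k) * Beta (Re c + real k) (Re r)" for k
  proof -
    have "norm (F k v) = norm (w k) * (indicator {0<..<1} v *\<^sub>R (v powr (Re c + real k - 1) * (1 - v) powr (Re r - 1)))" for v
      by (simp add: F_def indicator_def norm_mult norm_cpow)
    then show ?thesis
      using Beta_integral_real(2)[of "Re c + real k" "Re r"] c r by (simp add: set_lebesgue_integral_def)
  qed
  have sF: "(\<lambda>k. F k v) sums (indicator {0<..<1} v *\<^sub>R (cpow v (c - 1) * cpow (1 - v) (r - 1) * g v))" for v
    using sums_mult[OF sums[of v], of "cpow v (c - 1) * cpow (1 - v) (r - 1)"] by (auto simp: F_alt indicator_def)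
  have snF: "summable (\<lambda>k. norm (F k v))" for v
    using summable_mult[OF norm[of v], of "norm (cpow v (c - 1) * cpow (1 - v) (r - 1))"]
    by (cases "0 < v \<and> v < 1") (auto simp: F_alt norm_mult mult.assoc)
  have snI: "summable (\<lambda>k. \<integral>v. norm (F k v) \<partial>lborel)" using summable by (simp add: nF)
  have eqF: "(\<lambda>v. \<Sum>k. F k v) = (\<lambda>v. indicator {0<..<1} v *\<^sub>R (cpow v (c - 1) * cpow (1 - v) (r - 1) * g v))"
    using sums_unique[OF sF] by (simp add: fun_eq_iff)
  show ?int using integrable_suminf[OF int _ snI] snF by (simp add: eqF set_integrable_def)
  show ?eq using integral_suminf[OF int _ snI] snF by (simp add: eqF set_lebesgue_integral_def LF)
qed

text \<open>The fundamental theorem of calculus on the open interval; the primitive \<open>v\<^sup>c/c\<close> vanishes at \<open>0\<close>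
  because \<open>Re c > 0\<close>.\<close>

lemma power_integral_complex:
  assumes "Re c > 0"
  shows "(LINT v:{0<..<1}|lborel. cpow v (c - 1)) = 1 / c"
proof -
  have c0: "c \<noteq> 0" using assms by auto
  have "(LBINT v=0..1. cpow v (c - 1)) = 1 / c - 0"
  proof (rule interval_integral_FTC_integrable)
    show "set_integrable lborel (einterval 0 1) (\<lambda>v. cpow v (c - 1))"
      using Beta_kernel_integrable[OF assms, of 1] by (simp add: cpow_def zero_ereal_def one_ereal_def)
    fix x assume "0 < ereal x" "ereal x < 1"
    then have x: "0 < x" by simp
    show "((\<lambda>v. cpow v c / c) has_vector_derivative cpow x (c - 1)) (at x)"
      using has_vector_derivative_mult_right[OF has_vector_derivative_cpow[OF x, of c], of "1/c"] c0 by simp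
    show "isCont (\<lambda>v. cpow v (c - 1)) x"
      using x unfolding cpow_def by (intro continuous_intros) auto
  next
    have "((\<lambda>v. cpow v c / c) \<longlongrightarrow> 0) (at_right 0)"
    proof (rule Lim_null_comparison)
      show "\<forall>\<^sub>F v in at_right 0. norm (cpow v c / c) \<le> v powr Re c / norm c"
        using eventually_at_right_less[of "0::real"] by eventually_elim (simp add: norm_divide norm_cpow)
      show "((\<lambda>v. v powr Re c / norm c) \<longlongrightarrow> 0) (at_right 0)"
        using assms c0 by real_asymp
    qed
    then show "(((\<lambda>v. cpow v c / c) \<circ> real_of_ereal) \<longlongrightarrow> 0) (at_right 0)"
      by (simp add: zero_ereal_def ereal_tendsto_simps)
    have "((\<lambda>v. cpow v c / c) \<longlongrightarrow> cpow 1 c / c) (at_left 1)"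
      unfolding cpow_def by (intro tendsto_intros) (use c0 in auto)
    then show "(((\<lambda>v. cpow v c / c) \<circ> real_of_ereal) \<longlongrightarrow> 1 / c) (at_left 1)"
      by (simp add: one_ereal_def ereal_tendsto_simps cpow_def)
  qed auto
  then show ?thesis by (simp add: interval_lebesgue_integral_def zero_ereal_def one_ereal_def)
qed

lemma Beta_1_right: "Re c > 0 \<Longrightarrow> Beta c 1 = 1 / (c::complex)"
  using Gamma_plus1[of c] Re_pos_notin_nonpos_Ints[of c]
  by (auto simp: Beta_def Gamma_eq_zero_iff)

text \<open>Expanding \<open>(1-v)\<^bsup>r-1\<^esup>\<close> binomially and integrating termwise gives the Gauss series with parameters
  \<open>1-r\<close>, \<open>c\<close>, \<open>c+1\<close> at \<open>1\<close>, divided by \<open>c\<close>.\<close>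

lemma Beta_integral_complex:
  assumes c: "Re c > 0" and r: "Re r > 0"
  shows "(LINT v:{0<..<1}|lborel. cpow v (c - 1) * cpow (1 - v) (r - 1)) = Beta c r"
proof -
  define w where "w k = pochhammer (1 - r) k / fact k" for k
  have c0: "c \<noteq> 0" using c by auto
  have cn: "c \<notin> \<int>\<^sub>\<le>\<^sub>0" "c + 1 \<notin> \<int>\<^sub>\<le>\<^sub>0" using c by (auto intro!: Re_pos_notin_nonpos_Ints)
  have poch1: "pochhammer c k / pochhammer (c + 1) k = c / (c + of_nat k)" if "Re c > 0" for k and c :: complex
  proof -
    have "c * pochhammer (c + 1) k = pochhammer c k * (c + of_nat k)"
      using pochhammer_rec[of c k] pochhammer_Suc[of c k] by simp
    moreover have "pochhammer (c + 1) k \<noteq> 0"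
      using that Re_pos_notin_nonpos_Ints[of "c+1"] by (auto simp: pochhammer_eq_0_iff)
    moreover have "Re (c + of_nat k) > 0" using that by simp
    then have "c + of_nat k \<noteq> 0" by (metis less_irrefl zero_complex.sel(1))
    ultimately show ?thesis by (simp add: field_simps)
  qed
  have w1: "w k * (1 / (c + of_nat k)) = 1 / c * hyp_coeff (1 - r) c (c + 1) k" if "Re c > 0" for k c
  proof -
    have "c \<noteq> 0" using that by auto
    then have "w k * (1 / (c + of_nat k)) = w k * (1 / c * (pochhammer c k / pochhammer (c + 1) k))"
      unfolding poch1[OF that] by simp
    then show ?thesis by (simp add: w_def hyp_coeff_def)
  qed
  (* The L^1 norms of the terms are the terms of a Gauss series with c replaced by its real part. *)
  define C where "C = complex_of_real (Re c)"
  have C: "Re C > 0" using c by (simp add: C_def)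
  have "norm (w k) * Beta (Re c + real k) 1 = norm (1 / C * hyp_coeff (1 - r) C (C + 1) k)" for k
  proof -
    have "complex_of_real (Beta (Re c + real k) 1) = 1 / (C + of_nat k)"
      using Beta_1_right[of "C + of_nat k"] c Beta_complex_of_real[of "Re c + real k" 1] by (simp add: C_def)
    note e = this
    have "norm (complex_of_real (Beta (Re c + real k) 1)) = norm (1 / (C + of_nat k))"
      unfolding e ..
    moreover have "Beta (Re c + real k) 1 > 0" using c by (simp add: Beta_def)
    ultimately have "Beta (Re c + real k) 1 = norm (1 / (C + of_nat k))"
      by (simp only: norm_of_real abs_of_pos)
    then have "norm (w k) * Beta (Re c + real k) 1 = norm (w k * (1 / (C + of_nat k)))"
      by (simp only: norm_mult)
    then show ?thesis unfolding w1[OF C] .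
  qed
  moreover have "summable (\<lambda>k. norm (hyp_coeff (1 - r) C (C + 1) k))"
    using C r by (intro summable_hyp_coeff Re_pos_notin_nonpos_Ints) auto
  ultimately have sB: "summable (\<lambda>k. norm (w k) * Beta (Re c + real k) (Re 1))"
    by (simp add: norm_divide summable_divide)
  have wv: "w k * of_real v ^ k = ((r - 1) gchoose k) * of_real (-v) ^ k" for k v
  proof -
    have "((r - 1) gchoose k) = (-1) ^ k * w k"
      by (simp add: w_def gbinomial_pochhammer)
    then have "((r - 1) gchoose k) * of_real (-v) ^ k = ((-1) ^ k * w k) * ((-1) ^ k * of_real v ^ k)"
      by (metis of_real_minus power_minus)
    also have "\<dots> = ((-1) ^ k * (-1) ^ k) * (w k * of_real v ^ k)" by (simp only: mult_ac)
    also have "(-1) ^ k * (-1) ^ k = (1 :: complex)" by (simp flip: power_mult_distrib)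
    finally show ?thesis by simp
  qed
  have sums: "(\<lambda>k. w k * of_real v ^ k) sums cpow (1 - v) (r - 1)" if "0 < v" "v < 1" for v
    using gen_binomial_complex[of "of_real (-v)" "r - 1"] that cpow_eq_powr[of "1 - v" "r - 1"] by (simp add: wv)
  have "w k = hyp_coeff (1 - r) 1 1 k" for k by (simp add: w_def hyp_coeff_def pochhammer_fact[symmetric])
  then have norms: "summable (\<lambda>k. norm (w k * of_real v ^ k))" if "0 < v" "v < 1" for v
    using hyp_coeff_power_summable[OF _ that, of 1 "1 - r" 1] by (simp add: Re_pos_notin_nonpos_Ints)
  have "(LINT v:{0<..<1}|lborel. cpow v (c - 1) * cpow (1 - v) (r - 1)) = (LINT v:{0<..<1}|lborel. cpow v (c - 1) * cpow (1 - v) (1 - 1) * cpow (1 - v) (r - 1))"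
    by (simp add: cpow_def)
  also have "\<dots> = (\<Sum>k. w k * (LINT v:{0<..<1}|lborel. cpow v (c + of_nat k - 1) * cpow (1 - v) (1 - 1)))"
    by (rule termwise_Beta_integral(2)[OF c _ sums norms sB]) auto
  also have "\<dots> = (\<Sum>k. w k * (1 / (c + of_nat k)))"
    using power_integral_complex[of "c + of_nat _"] c by (simp add: cpow_def)
  also have "\<dots> = (\<Sum>k. 1 / c * hyp_coeff (1 - r) c (c + 1) k)"
    using w1[OF c] by simp
  also have "(\<lambda>k. 1 / c * hyp_coeff (1 - r) c (c + 1) k) sums (1 / c * (Gamma (c + 1) * Gamma (c + 1 - (1 - r) - c) * rGamma (c + 1 - (1 - r)) * rGamma (c + 1 - c)))"
    using c r by (intro sums_mult Gauss_summation) auto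
  then have "(\<Sum>k. 1 / c * hyp_coeff (1 - r) c (c + 1) k) = 1 / c * (c * Gamma c * Gamma r * rGamma (c + r))"
    using cn(1) by (subst Gamma_plus1[symmetric]) (simp_all add: sums_iff rGamma_inverse_Gamma)
  finally show ?thesis using c0 by (simp add: Beta_altdef)
qed

lemma hyp2F1_sums:
  assumes "c \<notin> \<int>\<^sub>\<le>\<^sub>0" "0 < v" "v < 1"
  shows "(\<lambda>k. hyp_coeff a b c k * of_real v ^ k) sums hyp2F1 a b c (of_real v)"
proof -
  have "hyp2F1 a b c (of_real v) = (\<Sum>k. hyp_coeff a b c k * of_real v ^ k)"
    by (simp add: hyp2F1_def eval_fps_def hyp_coeff_def)
  then show ?thesis
    using summable_norm_cancel[OF hyp_coeff_power_summable[OF assms]] by (simp add: sums_iff)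
qed

text \<open>Termwise integration multiplies the \<open>k\<close>-th coefficient by \<open>B(c+k,r) = B(c,r) (c)\<^sub>k / (c+r)\<^sub>k\<close>. The
  factor \<open>(c)\<^sub>k\<close> cancels, and a Gauss series with lower parameter \<open>c+r\<close> at \<open>1\<close> remains.\<close>

theorem hyp2F1_Beta_integral:
  assumes c: "Re c > 0" and r: "Re r > 0" and s: "Re (r + c - a - b) > 0"
  shows "set_integrable lborel {0<..<1} (\<lambda>v. cpow v (c - 1) * cpow (1 - v) (r - 1) * hyp2F1 a b c (of_real v))" (is ?int)
    and "(LINT v:{0<..<1}|lborel. cpow v (c - 1) * cpow (1 - v) (r - 1) * hyp2F1 a b c (of_real v))
      = Gamma c * Gamma r * Gamma (r + c - a - b) * rGamma (r + c - a) * rGamma (r + c - b)" (is ?eq)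
proof -
  have cn: "c \<notin> \<int>\<^sub>\<le>\<^sub>0" "c + r \<notin> \<int>\<^sub>\<le>\<^sub>0" using c r by (auto intro!: Re_pos_notin_nonpos_Ints)
  have s': "Re c + Re r - Re a - Re b > 0" using s by simp
  note sums = hyp2F1_sums[OF cn(1), of _ a b]
  note norms = hyp_coeff_power_summable[OF cn(1), of _ a b]
  have rn: "Re c \<notin> \<int>\<^sub>\<le>\<^sub>0" "Re c + Re r \<notin> \<int>\<^sub>\<le>\<^sub>0" using c r by (auto elim!: nonpos_Ints_cases)
  have sB: "summable (\<lambda>k. norm (hyp_coeff a b c k) * Beta (Re c + real k) (Re r))"
  proof -
    (* The k-th summand is of order k^(-1 - Re (r + c - a - b)). *)
    obtain K where K: "K > 0"
       "\<And>n. norm (hyp_coeff a b c (Suc n)) \<le> K * (exp (- Re (c - a - b) * ln (real n)) / Suc n)"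
      using hyp_coeff_bound[OF cn(1)] by metis
    obtain A where A: "A > 0" "\<And>n. norm (pochhammer (of_real (Re c) :: complex) (Suc n)) \<le> A * (fact n * exp (Re c * ln (real n)))"
      using norm_pochhammer_upper[of "of_real (Re c)"] by (metis Re_complex_of_real)
    have "complex_of_real (Re c + Re r) \<notin> \<int>\<^sub>\<le>\<^sub>0" using c r by (intro Re_pos_notin_nonpos_Ints) auto
    from norm_pochhammer_lower[OF this]
    obtain B where B: "B > 0" "\<And>n. fact n * exp ((Re c + Re r) * ln (real n)) \<le> B * norm (pochhammer (of_real (Re c + Re r) :: complex) (Suc n))"
      by (metis Re_complex_of_real)
    have p: "pochhammer (Re c) k > 0" "pochhammer (Re c + Re r) k > 0" for k using c r by (auto intro!: pochhammer_pos)
    have q: "pochhammer (Re c) (Suc n) / pochhammer (Re c + Re r) (Suc n) \<le> A * B * exp (- Re r * ln (real n))" for n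
    proof -
      have "pochhammer (Re c) (Suc n) \<le> A * (fact n * exp (Re c * ln (real n)))"
        using A(2)[of n] p(1)[of "Suc n"] by (simp only: pochhammer_of_real norm_of_real)
      moreover have "fact n * exp ((Re c + Re r) * ln (real n)) / B \<le> pochhammer (Re c + Re r) (Suc n)"
        using B(2)[of n] p(2)[of "Suc n"] B(1) by (simp only: pochhammer_of_real norm_of_real) (simp add: field_simps)
      ultimately have "pochhammer (Re c) (Suc n) / pochhammer (Re c + Re r) (Suc n) \<le>
          A * (fact n * exp (Re c * ln (real n))) / (fact n * exp ((Re c + Re r) * ln (real n)) / B)"
        using A(1) B(1) by (intro frac_le) auto
      also have "\<dots> = A * B * exp (- Re r * ln (real n))"
        using A(1) B(1) by (simp add: distrib_right exp_add exp_minus divide_simps)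
      finally show ?thesis .
    qed
    have "summable (\<lambda>n. norm (hyp_coeff a b c (Suc n)) * Beta (Re c + real (Suc n)) (Re r))"
    proof (rule summable_comparison_test_ev)
      define d where "d = Re c + Re r - Re a - Re b"
      define K' where "K' = K * (Beta (Re c) (Re r) * (A * B))"
      have Bpos: "Beta (Re c) (Re r) > 0" using c r by (simp add: Beta_def)
      show "summable (\<lambda>n. K' * real n powr (- d - 1))"
        using s' by (intro summable_mult) (simp add: summable_real_powr_iff d_def)
      show "\<forall>\<^sub>F n in sequentially. norm (norm (hyp_coeff a b c (Suc n)) * Beta (Re c + real (Suc n)) (Re r)) \<le> K' * real n powr (- d - 1)"
        using eventually_gt_at_top[of 0]
      proof eventually_elim
        case (elim n)
        have "norm (norm (hyp_coeff a b c (Suc n)) * Beta (Re c + real (Suc n)) (Re r)) =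
           norm (hyp_coeff a b c (Suc n)) * (Beta (Re c) (Re r) * (pochhammer (Re c) (Suc n) / pochhammer (Re c + Re r) (Suc n)))"
          unfolding Beta_shift_left[OF rn] using Bpos p[of "Suc n"] by (simp add: abs_mult less_imp_le del: pochhammer_Suc)
        also have "\<dots> \<le> (K * (exp (- Re (c - a - b) * ln (real n)) / Suc n)) * (Beta (Re c) (Re r) * (A * B * exp (- Re r * ln (real n))))"
          using K(1) Bpos p(1)[of "Suc n"] p(2)[of "Suc n"]
          by (intro mult_mono K(2) mult_left_mono q) (auto intro!: mult_nonneg_nonneg divide_nonneg_pos less_imp_le simp del: pochhammer_Suc)
        also have "\<dots> = K' * ((exp (- Re (c - a - b) * ln (real n)) * exp (- Re r * ln (real n))) / Suc n)"
          by (simp add: K'_def)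
        also have "exp (- Re (c - a - b) * ln (real n)) * exp (- Re r * ln (real n)) = exp (-d * ln (real n))"
          by (simp add: d_def algebra_simps flip: exp_add)
        also have "K' * (exp (-d * ln (real n)) / Suc n) \<le> K' * (exp (-d * ln (real n)) / n)"
          using elim K(1) A(1) B(1) Bpos by (intro mult_left_mono divide_left_mono) (auto simp: K'_def)
        also have "exp (-d * ln (real n)) / n = real n powr (- d - 1)"
          using elim by (simp add: powr_def left_diff_distrib exp_diff)
        finally show ?case .
      qed
    qed
    then show ?thesis by (subst (asm) summable_Suc_iff)
  qed
  show ?int
    by (rule termwise_Beta_integral(1)[OF c r sums norms sB])
  have "(LINT v:{0<..<1}|lborel. cpow v (c - 1) * cpow (1 - v) (r - 1) * hyp2F1 a b c (of_real v)) =
    (\<Sum>k. hyp_coeff a b c k * (LINT v:{0<..<1}|lborel. cpow v (c + of_nat k - 1) * cpow (1 - v) (r - 1)))"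
    by (rule termwise_Beta_integral(2)[OF c r sums norms sB])
  also have "\<dots> = (\<Sum>k. Beta c r * hyp_coeff a b (c + r) k)"
  proof (rule suminf_cong)
    fix k
    have "(LINT v:{0<..<1}|lborel. cpow v (c + of_nat k - 1) * cpow (1 - v) (r - 1)) = Beta (c + of_nat k) r"
      using c r by (intro Beta_integral_complex) auto
    also have "\<dots> = Beta c r * (pochhammer c k / pochhammer (c + r) k)"
      by (rule Beta_shift_left[OF cn])
    finally show "hyp_coeff a b c k * (LINT v:{0<..<1}|lborel. cpow v (c + of_nat k - 1) * cpow (1 - v) (r - 1)) = Beta c r * hyp_coeff a b (c + r) k"
      using cn(1) by (simp add: hyp_coeff_def pochhammer_eq_0_iff) (auto simp: field_simps pochhammer_eq_0_iff)
  qed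
  also have "(\<lambda>k. Beta c r * hyp_coeff a b (c + r) k) sums (Beta c r * (Gamma (c + r) * Gamma (c + r - a - b) * rGamma (c + r - a) * rGamma (c + r - b)))"
    using c r s' by (intro sums_mult Gauss_summation) auto
  then have "(\<Sum>k. Beta c r * hyp_coeff a b (c + r) k) = Beta c r * (Gamma (c + r) * Gamma (c + r - a - b) * rGamma (c + r - a) * rGamma (c + r - b))"
    by (simp add: sums_iff)
  also have "\<dots> = Gamma c * Gamma r * Gamma (r + c - a - b) * rGamma (r + c - a) * rGamma (r + c - b)"
    using cn(2) by (simp add: Beta_def Gamma_eq_zero_iff add.commute)
  finally show ?eq .
qed

section \<open>Growth of the Gamma function on vertical lines\<close>

text \<open>Comparing with \<open>\<Gamma>(x)\<close> leaves, by Euler's formula, a sum over \<open>k\<close> of one function of \<open>x + k\<close>.\<close>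

definition ln_Gamma_drop :: "real \<Rightarrow> real \<Rightarrow> real" where
  "ln_Gamma_drop t x = ln (Gamma x / norm (Gamma (Complex x t)))"

lemma Complex_notin_nonpos_Ints: "t \<noteq> 0 \<Longrightarrow> Complex x t \<notin> \<int>\<^sub>\<le>\<^sub>0"
  by (auto elim!: nonpos_Ints_cases simp: complex_eq_iff)

lemma convex_on_ln_hypot:
  "convex_on {0<..} (\<lambda>x. ln (x\<^sup>2 + t\<^sup>2) / 2 - ln x :: real)"
proof (rule f''_ge0_imp_convex)
  fix x :: real assume "x \<in> {0<..}"
  then have x: "x > 0" and q: "x\<^sup>2 + t\<^sup>2 > 0" by (auto simp: add_pos_nonneg)
  show "((\<lambda>x. ln (x\<^sup>2 + t\<^sup>2) / 2 - ln x) has_real_derivative x / (x\<^sup>2 + t\<^sup>2) - 1 / x) (at x)"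
  proof -
    have "x\<^sup>2 * 4 + t\<^sup>2 * 4 \<noteq> 0" using q by linarith
    then show ?thesis
      using x q by (auto intro!: derivative_eq_intros simp: frac_eq_eq algebra_simps)
  qed
  show "((\<lambda>x. x / (x\<^sup>2 + t\<^sup>2) - 1 / x) has_real_derivative (t\<^sup>2 - x\<^sup>2) / (x\<^sup>2 + t\<^sup>2)\<^sup>2 + 1 / x\<^sup>2) (at x)"
    using x q by (auto intro!: derivative_eq_intros simp: power2_eq_square)
  have "(t\<^sup>2 - x\<^sup>2) / (x\<^sup>2 + t\<^sup>2)\<^sup>2 + 1 / x\<^sup>2 = (3 * x\<^sup>2 * t\<^sup>2 + t ^ 4) / ((x\<^sup>2 + t\<^sup>2)\<^sup>2 * x\<^sup>2)"
  proof -
    have "(v - y) / (y + v)\<^sup>2 + 1 / y = (3 * y * v + v\<^sup>2) / ((y + v)\<^sup>2 * y)" if "y > 0" "y + v > 0" for y v :: real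
      using that by (simp add: divide_simps) (simp add: algebra_simps power2_eq_square)
    from this[of "x\<^sup>2" "t\<^sup>2"] show ?thesis using x q by simp
  qed
  also have "\<dots> \<ge> 0" by simp
  finally show "(t\<^sup>2 - x\<^sup>2) / (x\<^sup>2 + t\<^sup>2)\<^sup>2 + 1 / x\<^sup>2 \<ge> 0" .
qed auto

text \<open>In Euler's formula for \<open>\<Gamma>(x)\<close> and \<open>\<Gamma>(x + \<i>t)\<close> the powers of \<open>n\<close> have the same modulus, so only the
  quotients \<open>|x + k + \<i>t| / (x + k)\<close> survive.\<close>

lemma ln_Gamma_drop_LIMSEQ:
  assumes "x > 0"
  shows "(\<lambda>n. \<Sum>k\<le>n. ln ((x + real k)\<^sup>2 + t\<^sup>2) / 2 - ln (x + real k)) \<longlonglongrightarrow> ln_Gamma_drop t x"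
proof -
  have nz: "Complex x t \<notin> \<int>\<^sub>\<le>\<^sub>0" using assms by (auto elim!: nonpos_Ints_cases simp: complex_eq_iff)
  have xn: "x \<notin> \<int>\<^sub>\<le>\<^sub>0" using assms by (auto elim!: nonpos_Ints_cases)
  have Gx: "Gamma x > 0" using assms by simp
  have "(\<lambda>n. ln (Gamma_series x n / norm (Gamma_series (Complex x t) n))) \<longlonglongrightarrow> ln_Gamma_drop t x"
    unfolding ln_Gamma_drop_def using Gx nz xn
    by (intro tendsto_ln tendsto_divide tendsto_norm Gamma_series_LIMSEQ) (auto simp: Gamma_eq_zero_iff)
  moreover have "ln (Gamma_series x n / norm (Gamma_series (Complex x t) n)) =
     (\<Sum>k\<le>n. ln ((x + real k)\<^sup>2 + t\<^sup>2) / 2 - ln (x + real k))" for n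
  proof -
    have pos: "x + real k > 0" "(x + real k)\<^sup>2 + t\<^sup>2 > 0" for k
      using assms by (auto intro: add_pos_nonneg)
    have n: "norm (Complex x t + of_nat k) = sqrt ((x + real k)\<^sup>2 + t\<^sup>2)" for k
      by (simp add: cmod_def)
    have "Gamma_series x n / norm (Gamma_series (Complex x t) n) = norm (pochhammer (Complex x t) (Suc n)) / pochhammer x (Suc n)"
      using assms by (simp add: Gamma_series_def norm_divide norm_mult del: pochhammer_Suc)
    also have "\<dots> = (\<Prod>k\<le>n. sqrt ((x + real k)\<^sup>2 + t\<^sup>2) / (x + real k))"
      by (simp add: pochhammer_Suc_prod prod_norm[symmetric] n prod_dividef lessThan_Suc_atMost atLeast0AtMost del: pochhammer_Suc)
    also have "ln \<dots> = (\<Sum>k\<le>n. ln (sqrt ((x + real k)\<^sup>2 + t\<^sup>2) / (x + real k)))"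
      using pos less_imp_neq[OF pos(1)] by (intro ln_prod divide_pos_pos) (auto simp del: zero_less_divide_iff)
    also have "\<dots> = (\<Sum>k\<le>n. ln ((x + real k)\<^sup>2 + t\<^sup>2) / 2 - ln (x + real k))"
      using pos less_imp_neq[OF pos(1), symmetric] by (intro sum.cong refl) (simp add: ln_div ln_sqrt)
    finally show ?thesis .
  qed
  ultimately show ?thesis by simp
qed

lemma convex_on_ln_Gamma_drop: "convex_on {0<..} (ln_Gamma_drop t)"
proof (intro convex_onI)
  fix u x y :: real assume u: "0 < u" "u < 1" and xy: "x \<in> {0<..}" "y \<in> {0<..}"
  define h where "h x = ln (x\<^sup>2 + t\<^sup>2) / 2 - ln x" for x
  have h: "h ((1 - u) * x + u * y) \<le> (1 - u) * h x + u * h y" if "x > 0" "y > 0" for x y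
    using convex_onD[OF convex_on_ln_hypot[of t], of u x y] u that by (simp add: h_def)
  have z: "(1 - u) * x + u * y > 0" using u xy by (simp add: add_pos_pos)
  have lim: "(\<lambda>n. \<Sum>k\<le>n. h (x + real k)) \<longlonglongrightarrow> ln_Gamma_drop t x" if "x > 0" for x
    using ln_Gamma_drop_LIMSEQ[OF that, of t] by (simp add: h_def)
  have "ln_Gamma_drop t ((1 - u) * x + u * y) \<le> (1 - u) * ln_Gamma_drop t x + u * ln_Gamma_drop t y"
  proof (rule LIMSEQ_le)
    show "(\<lambda>n. \<Sum>k\<le>n. h ((1 - u) * x + u * y + real k)) \<longlonglongrightarrow> ln_Gamma_drop t ((1 - u) * x + u * y)"
      using z by (rule lim)
    show "(\<lambda>n. (1 - u) * (\<Sum>k\<le>n. h (x + real k)) + u * (\<Sum>k\<le>n. h (y + real k))) \<longlonglongrightarrow> (1 - u) * ln_Gamma_drop t x + u * ln_Gamma_drop t y"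
      using xy by (intro tendsto_intros lim) auto
    have "h ((1 - u) * x + u * y + real k) \<le> (1 - u) * h (x + real k) + u * h (y + real k)" for k
      using h[of "x + real k" "y + real k"] xy by (simp add: algebra_simps)
    then show "\<exists>N. \<forall>n\<ge>N. (\<Sum>k\<le>n. h ((1 - u) * x + u * y + real k)) \<le> (1 - u) * (\<Sum>k\<le>n. h (x + real k)) + u * (\<Sum>k\<le>n. h (y + real k))"
      by (auto simp: sum_distrib_left sum.distrib[symmetric] intro!: sum_mono)
  qed
  then show "ln_Gamma_drop t ((1 - u) *\<^sub>R x + u *\<^sub>R y) \<le> (1 - u) * ln_Gamma_drop t x + u * ln_Gamma_drop t y"
    by simp
qed simp

text \<open>On the line \<open>Re z = 1/2\<close> one has \<open>1 - z = cnj z\<close>, so the reflection formula yields \<open>|\<Gamma>(z)|\<^sup>2\<close>.\<close>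

lemma norm_Gamma_half: "norm (Gamma (Complex (1/2) t)) = sqrt (pi / cosh (pi * t))"
proof -
  define z where "z = Complex (1/2) t"
  have "Gamma z * Gamma (1 - z) = of_real pi / sin (of_real pi * z)"
    by (rule Gamma_reflection_complex)
  moreover have "1 - z = cnj z" by (simp add: z_def complex_eq_iff)
  moreover have "sin (of_real pi * z) = of_real (cosh (pi * t))"
  proof -
    have "of_real pi * z = \<i> * of_real (pi * t) + of_real pi / 2"
      by (simp add: z_def complex_eq_iff)
    then have "sin (of_real pi * z) = cos (\<i> * of_real (pi * t))" by (simp add: sin_add)
    also have "\<dots> = cosh (of_real (pi * t))" by (simp add: cosh_conv_cos)
    also have "\<dots> = of_real (cosh (pi * t))"
      by (simp add: cosh_def exp_of_real scaleR_conv_of_real del: of_real_mult flip: of_real_minus)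
    finally show ?thesis .
  qed
  moreover have "Gamma z * Gamma (cnj z) = of_real ((norm (Gamma z))\<^sup>2)"
    by (metis cnj_Gamma complex_norm_square)
  ultimately have "complex_of_real ((norm (Gamma z))\<^sup>2) = of_real (pi / cosh (pi * t))" by simp
  then have "(norm (Gamma z))\<^sup>2 = pi / cosh (pi * t)" by (simp only: of_real_eq_iff)
  then show ?thesis unfolding z_def[symmetric] by (metis abs_norm_cancel real_sqrt_abs)
qed


lemma ln_Gamma_drop_plus1:
  assumes "x > 0"
  shows "ln_Gamma_drop t (x + 1) = ln_Gamma_drop t x + ln x - ln (norm (Complex x t))"
proof -
  have nz: "Complex x t \<notin> \<int>\<^sub>\<le>\<^sub>0" using assms by (auto elim!: nonpos_Ints_cases simp: complex_eq_iff)
  have xn: "x \<notin> \<int>\<^sub>\<le>\<^sub>0" using assms by (auto elim!: nonpos_Ints_cases)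
  have "Complex (x + 1) t = Complex x t + 1" by (simp add: complex_eq_iff)
  then have "Gamma (Complex (x + 1) t) = Complex x t * Gamma (Complex x t)"
    using Gamma_plus1[OF nz] by simp
  moreover have "Complex x t \<noteq> 0" "Gamma (Complex x t) \<noteq> 0" using nz assms by (auto simp: Gamma_eq_zero_iff)
  moreover have "Gamma x \<noteq> 0" using assms by (metis Gamma_real_pos less_irrefl)
  ultimately show ?thesis
    using Gamma_plus1[OF xn] assms by (simp add: ln_Gamma_drop_def norm_mult ln_div ln_mult)
qed

text \<open>A convex function lies below its chord over \<open>[3/2, 5/2]\<close> and, to the right of \<open>3/2\<close>, above the
  extension of its chord over \<open>[1/2, 3/2]\<close>. The functional equation gives the slopes of both chords.
  Both slopes are \<open>- ln |t| + O(1)\<close> as \<open>|t| \<rightarrow> \<infinity>\<close>, so the two bounds differ by a bounded amount.\<close>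

lemma ln_Gamma_drop_between:
  assumes r: "0 \<le> r" "r \<le> 1"
  shows "ln_Gamma_drop t (3/2 + r) \<le> ln_Gamma_drop t (3/2) + r * (ln (3/2) - ln (norm (Complex (3/2) t)))"
    and "ln_Gamma_drop t (3/2 + r) \<ge> ln_Gamma_drop t (3/2) + r * (ln (1/2) - ln (norm (Complex (1/2) t)))"
proof -
  have "ln_Gamma_drop t ((1 - r) *\<^sub>R (3/2) + r *\<^sub>R (5/2)) \<le> (1 - r) * ln_Gamma_drop t (3/2) + r * ln_Gamma_drop t (5/2)"
    using r by (intro convex_onD[OF convex_on_ln_Gamma_drop]) auto
  moreover have "(1 - r) *\<^sub>R (3/2) + r *\<^sub>R (5/2) = 3/2 + r"
    by (simp add: field_simps)
  moreover have "ln_Gamma_drop t (5/2) = ln_Gamma_drop t (3/2) + ln (3/2) - ln (norm (Complex (3/2) t))"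
    using ln_Gamma_drop_plus1[of "3/2" t] by simp
  ultimately show "ln_Gamma_drop t (3/2 + r) \<le> ln_Gamma_drop t (3/2) + r * (ln (3/2) - ln (norm (Complex (3/2) t)))"
    by (simp add: algebra_simps)
  (* the weight for which 3/2 is a convex combination of 1/2 and 3/2 + r *)
  define u where "u = 1 / (1 + r)"
  have "ln_Gamma_drop t ((1 - u) *\<^sub>R (1/2) + u *\<^sub>R (3/2 + r)) \<le> (1 - u) * ln_Gamma_drop t (1/2) + u * ln_Gamma_drop t (3/2 + r)"
    using r by (intro convex_onD[OF convex_on_ln_Gamma_drop]) (auto simp: u_def)
  moreover have "(1 - u) *\<^sub>R (1/2) + u *\<^sub>R (3/2 + r) = 3/2"
  proof -
    have "u * (1 + r) = 1" using r by (simp add: u_def)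
    then have "u * r = 1 - u" by (simp add: algebra_simps)
    moreover have "(1 - u) *\<^sub>R (1/2) + u *\<^sub>R (3/2 + r) = 1/2 + u + u * r"
      by (simp add: field_simps)
    ultimately show ?thesis by simp
  qed
  ultimately have "ln_Gamma_drop t (3/2) \<le> (1 - u) * ln_Gamma_drop t (1/2) + u * ln_Gamma_drop t (3/2 + r)" by (simp only:)
  then have "(1 + r) * ln_Gamma_drop t (3/2) \<le> (1 + r) * ((1 - u) * ln_Gamma_drop t (1/2) + u * ln_Gamma_drop t (3/2 + r))"
    using r by (intro mult_left_mono) auto
  also have "\<dots> = ((1 + r) * (1 - u)) * ln_Gamma_drop t (1/2) + ((1 + r) * u) * ln_Gamma_drop t (3/2 + r)"
    by (simp add: algebra_simps)
  also have "(1 + r) * u = 1" using r by (simp add: u_def)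
  also have "(1 + r) * (1 - u) = r" using r by (simp add: u_def field_simps)
  finally have "(1 + r) * ln_Gamma_drop t (3/2) \<le> r * ln_Gamma_drop t (1/2) + ln_Gamma_drop t (3/2 + r)" by simp
  moreover have "ln_Gamma_drop t (3/2) = ln_Gamma_drop t (1/2) + ln (1/2) - ln (norm (Complex (1/2) t))"
    using ln_Gamma_drop_plus1[of "1/2" t] by simp
  ultimately show "ln_Gamma_drop t (3/2 + r) \<ge> ln_Gamma_drop t (3/2) + r * (ln (1/2) - ln (norm (Complex (1/2) t)))"
    by (simp add: algebra_simps)
qed

lemma norm_Complex_bigtheta: "(\<lambda>t. norm (Complex x t)) \<in> \<Theta>[at_infinity](\<lambda>t::real. \<bar>t\<bar>)"
proof (rule bigthetaI)
  have ev: "eventually (\<lambda>t::real. \<bar>t\<bar> \<ge> \<bar>x\<bar> + 1) at_infinity"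
    using eventually_at_infinity by (auto simp: eventually_at_infinity)
  show "(\<lambda>t. norm (Complex x t)) \<in> O[at_infinity](\<lambda>t::real. \<bar>t\<bar>)"
  proof (rule bigoI[of _ 2])
    show "\<forall>\<^sub>F t in at_infinity. norm (norm (Complex x t)) \<le> 2 * norm \<bar>t\<bar>"
      using ev
    proof eventually_elim
      case (elim t)
      have "norm (Complex x t) \<le> \<bar>x\<bar> + \<bar>t\<bar>" using cmod_le[of "Complex x t"] by simp
      then show ?case using elim by simp
    qed
  qed
  show "(\<lambda>t. norm (Complex x t)) \<in> \<Omega>[at_infinity](\<lambda>t::real. \<bar>t\<bar>)"
  proof (rule landau_omega.bigI[of 1])
    show "\<forall>\<^sub>F t in at_infinity. norm (norm (Complex x t)) \<ge> 1 * norm \<bar>t\<bar>"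
      using abs_Im_le_cmod[of "Complex x _"] by (intro always_eventually) simp
  qed simp
qed

lemma eventually_nz_at_infinity: "eventually (\<lambda>t::real. t \<noteq> 0) at_infinity"
  unfolding eventually_at_infinity by (rule exI[of _ 1]) auto

definition envelope :: "real \<Rightarrow> real \<Rightarrow> real \<Rightarrow> real" where
  "envelope D e t = \<bar>t\<bar> powr e * exp (- (pi / 2 * D * \<bar>t\<bar>))"

lemma norm_Gamma_half_bigtheta: "(\<lambda>t. norm (Gamma (Complex (1/2) t))) \<in> \<Theta>[at_infinity](envelope 1 0)"
proof (rule bigthetaI)
  have ev: "envelope 1 0 t = exp (- (pi/2) * \<bar>t\<bar>)" if "t \<noteq> 0" for t using that by (simp add: envelope_def)
  have sq: "(exp (- (pi/2) * \<bar>t\<bar>))\<^sup>2 = exp (- pi * \<bar>t\<bar>)" for t :: real by (simp add: power2_eq_square flip: exp_add)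
  have c: "cosh (pi * t) = (exp (pi * \<bar>t\<bar>) + exp (- pi * \<bar>t\<bar>)) / 2" for t :: real by (simp add: cosh_def abs_if)
  have c1: "cosh (pi * t) \<le> exp (pi * \<bar>t\<bar>)" for t :: real
  proof -
    have "exp (- pi * \<bar>t\<bar>) \<le> exp (pi * \<bar>t\<bar>)" by simp
    then show ?thesis unfolding c by (simp only: divide_le_eq_numeral1 mult_2_right add_left_mono)
  qed
  have c2: "cosh (pi * t) \<ge> exp (pi * \<bar>t\<bar>) / 2" for t :: real
    using c[of t] exp_gt_zero[of "- pi * \<bar>t\<bar>"] by simp
  have l: "sqrt pi * exp (- (pi/2) * \<bar>t\<bar>) \<le> norm (Gamma (Complex (1/2) t))" for t
    unfolding norm_Gamma_half using c1[of t] sq[of t]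
    by (intro real_le_rsqrt) (simp add: power_mult_distrib exp_minus field_simps cosh_real_pos)
  have u: "norm (Gamma (Complex (1/2) t)) \<le> sqrt (2 * pi) * exp (- (pi/2) * \<bar>t\<bar>)" for t
    unfolding norm_Gamma_half using c2[of t] sq[of t]
    by (intro real_le_lsqrt) (simp_all add: power_mult_distrib exp_minus field_simps cosh_real_pos less_imp_le)
  show "(\<lambda>t. norm (Gamma (Complex (1/2) t))) \<in> O[at_infinity](envelope 1 0)"
    by (rule bigoI[of _ "sqrt (2 * pi)"], rule eventually_mono[OF eventually_nz_at_infinity]) (use u ev in auto)
  show "(\<lambda>t. norm (Gamma (Complex (1/2) t))) \<in> \<Omega>[at_infinity](envelope 1 0)"
    by (rule landau_omega.bigI[of "sqrt pi"], simp, rule eventually_mono[OF eventually_nz_at_infinity]) (use l ev in auto)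
qed

lemma norm_Gamma_plus1_bigtheta_iff:
  "(\<lambda>t. norm (Gamma (Complex (x + 1) t))) \<in> \<Theta>[at_infinity](envelope 1 (e + 1)) \<longleftrightarrow>
   (\<lambda>t. norm (Gamma (Complex x t))) \<in> \<Theta>[at_infinity](envelope 1 e)"
proof -
  have "(\<lambda>t. norm (Gamma (Complex (x + 1) t))) \<in> \<Theta>[at_infinity](envelope 1 (e + 1)) \<longleftrightarrow>
    (\<lambda>t. norm (Complex x t) * norm (Gamma (Complex x t))) \<in> \<Theta>[at_infinity](\<lambda>t. \<bar>t\<bar> * envelope 1 e t)"
  proof (rule landau_theta.cong_ex)
    show "\<forall>\<^sub>F t in at_infinity. norm (Gamma (Complex (x + 1) t)) = norm (Complex x t) * norm (Gamma (Complex x t))"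
      using eventually_nz_at_infinity
    proof eventually_elim
      case (elim t)
      have "Complex (x + 1) t = Complex x t + 1" by (simp add: complex_eq_iff)
      then show ?case using Gamma_plus1[OF Complex_notin_nonpos_Ints[OF elim, of x]] by (simp add: norm_mult)
    qed
    show "\<forall>\<^sub>F t in at_infinity. envelope 1 (e + 1) t = \<bar>t\<bar> * envelope 1 e t"
      using eventually_nz_at_infinity by eventually_elim (simp add: envelope_def powr_add)
  qed
  also have "\<dots> \<longleftrightarrow> (\<lambda>t. \<bar>t\<bar> * norm (Gamma (Complex x t))) \<in> \<Theta>[at_infinity](\<lambda>t. \<bar>t\<bar> * envelope 1 e t)"
    by (intro landau_theta.in_cong_bigtheta landau_theta.mult_right norm_Complex_bigtheta)
  also have "\<dots> \<longleftrightarrow> (\<lambda>t. norm (Gamma (Complex x t))) \<in> \<Theta>[at_infinity](envelope 1 e)"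
    by (intro landau_theta.mult_cancel_left) (auto intro: eventually_mono[OF eventually_nz_at_infinity])
  finally show ?thesis .
qed

text \<open>The bounds of \<open>ln_Gamma_drop_between\<close>, exponentiated.\<close>

lemma norm_Gamma_bigtheta_strip:
  assumes "0 \<le> r" "r \<le> 1"
  shows "(\<lambda>t. norm (Gamma (Complex (3/2 + r) t))) \<in> \<Theta>[at_infinity](envelope 1 (1 + r))"
proof -
  have G: "norm (Gamma (Complex x t)) = Gamma x * exp (- ln_Gamma_drop t x)" if "x > 0" for x t
  proof -
    have "Complex x t \<notin> \<int>\<^sub>\<le>\<^sub>0" "x \<notin> \<int>\<^sub>\<le>\<^sub>0" using that by (auto elim!: nonpos_Ints_cases simp: complex_eq_iff)
    then show ?thesis using that by (simp add: ln_Gamma_drop_def exp_minus Gamma_eq_zero_iff)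
  qed
  define g where "g t = norm (Gamma (Complex (3/2) t))" for t
  define K where "K = Gamma (3/2 + r) / Gamma (3/2)"
  have K: "K > 0" using assms by (simp add: K_def)
  have P: "(norm (Complex x t) / x) powr r = exp (- (r * (ln x - ln (norm (Complex x t)))))" if "x > 0" for x t
  proof -
    have "norm (Complex x t) > 0" using that by (auto simp: complex_eq_iff)
    then show ?thesis using that by (simp add: powr_def ln_div algebra_simps)
  qed
  have half: "(0::real) < 1/2" and three_half: "(0::real) < 3/2" by simp_all
  have Kg: "K * (g t * y) = Gamma (3/2 + r) * (exp (- ln_Gamma_drop t (3/2)) * y)" for t y
    using G[of "3/2" t] Gamma_real_pos[of "3/2"] by (simp add: K_def g_def less_imp_neq[symmetric])
  have lo: "K * (g t * (norm (Complex (3/2) t) / (3/2)) powr r) \<le> norm (Gamma (Complex (3/2 + r) t))" for t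
    unfolding Kg P[of "3/2" t, OF three_half] using ln_Gamma_drop_between(1)[OF assms, of t] assms
    by (subst G) (auto intro!: mult_left_mono simp flip: exp_add)
  have up: "norm (Gamma (Complex (3/2 + r) t)) \<le> K * (g t * (norm (Complex (1/2) t) / (1/2)) powr r)" for t
    unfolding Kg P[of "1/2" t, OF half] using ln_Gamma_drop_between(2)[OF assms, of t] assms
    by (subst G) (auto intro!: mult_left_mono simp flip: exp_add)
  have th: "(\<lambda>t. g t * (norm (Complex x t) / x) powr r) \<in> \<Theta>[at_infinity](envelope 1 (1 + r))" if "x > 0" for x
  proof -
    have "g \<in> \<Theta>[at_infinity](envelope 1 1)"
      using norm_Gamma_plus1_bigtheta_iff[of "1/2" 0] norm_Gamma_half_bigtheta by (simp add: g_def [abs_def])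
    moreover have "(\<lambda>t. norm (Complex x t) / x) \<in> \<Theta>[at_infinity](\<lambda>t. \<bar>t\<bar>)"
      using that norm_Complex_bigtheta[of x] by simp
    then have "(\<lambda>t. \<bar>norm (Complex x t) / x\<bar> powr r) \<in> \<Theta>[at_infinity](\<lambda>t. \<bar>\<bar>t\<bar>\<bar> powr r)"
      by (rule bigtheta_powr)
    ultimately have "(\<lambda>t. g t * \<bar>norm (Complex x t) / x\<bar> powr r) \<in> \<Theta>[at_infinity](\<lambda>t. envelope 1 1 t * \<bar>\<bar>t\<bar>\<bar> powr r)"
      by (rule landau_theta.mult)
    also have "(\<lambda>t. envelope 1 1 t * \<bar>\<bar>t\<bar>\<bar> powr r) = envelope 1 (1 + r)"
      by (auto simp: envelope_def powr_add fun_eq_iff)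
    finally show ?thesis using that by simp
  qed
  show ?thesis
  proof (rule bigthetaI)
    have "(\<lambda>t. norm (Gamma (Complex (3/2 + r) t))) \<in> O[at_infinity](\<lambda>t. g t * (norm (Complex (1/2) t) / (1/2)) powr r)"
      using up by (intro bigoI[of _ K] always_eventually) (simp add: g_def)
    also have "(\<lambda>t. g t * (norm (Complex (1/2) t) / (1/2)) powr r) \<in> \<Theta>[at_infinity](envelope 1 (1 + r))"
      by (rule th) simp
    finally show "(\<lambda>t. norm (Gamma (Complex (3/2 + r) t))) \<in> O[at_infinity](envelope 1 (1 + r))" .
    have "(\<lambda>t. norm (Gamma (Complex (3/2 + r) t))) \<in> \<Omega>[at_infinity](\<lambda>t. g t * (norm (Complex (3/2) t) / (3/2)) powr r)"
      using lo K by (intro landau_omega.bigI[of K] always_eventually) (simp_all add: g_def)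
    also have "(\<lambda>t. g t * (norm (Complex (3/2) t) / (3/2)) powr r) \<in> \<Theta>[at_infinity](envelope 1 (1 + r))"
      by (rule th) simp
    finally show "(\<lambda>t. norm (Gamma (Complex (3/2 + r) t))) \<in> \<Omega>[at_infinity](envelope 1 (1 + r))" .
  qed
qed

text \<open>The functional equation moves every line by an integer into the strip \<open>3/2 \<le> Re z \<le> 5/2\<close>, since both
  sides are multiplied by quantities of order \<open>|t|\<close>.\<close>

theorem norm_Gamma_vertical_bigtheta:
  "(\<lambda>t. norm (Gamma (Complex x t))) \<in> \<Theta>[at_infinity](envelope 1 (x - 1/2))"
proof -
  have shift: "(\<lambda>t. norm (Gamma (Complex (y + of_int k) t))) \<in> \<Theta>[at_infinity](envelope 1 (y + of_int k - 1/2)) \<longleftrightarrow>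
     (\<lambda>t. norm (Gamma (Complex y t))) \<in> \<Theta>[at_infinity](envelope 1 (y - 1/2))" for y k
  proof (induction k rule: int_induct[of _ 0])
    case (step1 i)
    then show ?case
      using norm_Gamma_plus1_bigtheta_iff[of "y + of_int i" "y + of_int i - 1/2"] by (simp add: algebra_simps)
  next
    case (step2 i)
    then show ?case
      using norm_Gamma_plus1_bigtheta_iff[of "y + of_int i - 1" "y + of_int i - 1 - 1/2"] by (simp add: algebra_simps)
  qed simp
  define k where "k = \<lfloor>x - 3/2\<rfloor>"
  define r where "r = x - 3/2 - of_int k"
  have "0 \<le> r" "r \<le> 1" unfolding r_def k_def by linarith+
  from norm_Gamma_bigtheta_strip[OF this] show ?thesis
    using shift[of "3/2 + r" k] by (simp add: r_def algebra_simps)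
qed

lemma envelope_mult: "envelope D e t * envelope D' e' t = envelope (D + D') (e + e') t"
proof -
  have "exp (- (pi / 2 * (D + D') * \<bar>t\<bar>)) = exp (- (pi / 2 * D * \<bar>t\<bar>)) * exp (- (pi / 2 * D' * \<bar>t\<bar>))"
    unfolding exp_add[symmetric] by (simp only: exp_inj_iff) argo
  then show ?thesis by (simp add: envelope_def powr_add)
qed

lemma envelope_divide: "envelope D e t / envelope D' e' t = envelope (D - D') (e - e') t"
proof -
  have "exp (- (pi / 2 * (D - D') * \<bar>t\<bar>)) = exp (- (pi / 2 * D * \<bar>t\<bar>)) / exp (- (pi / 2 * D' * \<bar>t\<bar>))"
    unfolding exp_diff[symmetric] by (simp only: exp_inj_iff) argo
  then show ?thesis by (simp add: envelope_def powr_diff)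
qed

lemma envelope_nonneg: "envelope D e t \<ge> 0"
  by (simp add: envelope_def)

lemma envelope_powr: "envelope D e t powr k = envelope (k * D) (k * e) t"
  by (simp add: envelope_def powr_mult powr_powr exp_powr_real algebra_simps)

lemma affine_bigtheta:
  assumes "d \<noteq> 0"
  shows "(\<lambda>t. \<bar>b + d * t\<bar>) \<in> \<Theta>[at_infinity](\<lambda>t::real. \<bar>t\<bar>)"
proof -
  have "eventually (\<lambda>t::real. \<bar>b\<bar> \<le> \<bar>d\<bar> / 2 * \<bar>t\<bar>) at_infinity"
    unfolding eventually_at_infinity using assms by (intro exI[of _ "2 * \<bar>b\<bar> / \<bar>d\<bar>"]) (auto simp: field_simps)
  then have ev: "eventually (\<lambda>t::real. \<bar>d\<bar> / 2 * \<bar>t\<bar> \<le> \<bar>b + d * t\<bar> \<and> \<bar>b + d * t\<bar> \<le> 2 * \<bar>d\<bar> * \<bar>t\<bar>) at_infinity"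
  proof eventually_elim
    case (elim t)
    have "\<bar>d * t\<bar> = \<bar>d\<bar> * \<bar>t\<bar>" by (simp add: abs_mult)
    moreover have "\<bar>b + d * t\<bar> \<le> \<bar>b\<bar> + \<bar>d * t\<bar>" "\<bar>d * t\<bar> - \<bar>b\<bar> \<le> \<bar>b + d * t\<bar>" by linarith+
    ultimately show ?case using elim by auto
  qed
  show ?thesis
  proof (rule bigthetaI)
    show "(\<lambda>t. \<bar>b + d * t\<bar>) \<in> O[at_infinity](\<lambda>t::real. \<bar>t\<bar>)"
      using ev by (intro bigoI[of _ "2 * \<bar>d\<bar>"]) (auto elim: eventually_mono)
    show "(\<lambda>t. \<bar>b + d * t\<bar>) \<in> \<Omega>[at_infinity](\<lambda>t::real. \<bar>t\<bar>)"
      using ev assms by (intro landau_omega.bigI[of "\<bar>d\<bar>/2"]) (auto elim: eventually_mono)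
  qed
qed

lemma filterlim_affine_at_infinity:
  assumes "d \<noteq> (0::real)"
  shows "filterlim (\<lambda>t. b + d * t) at_infinity at_infinity"
  unfolding filterlim_at_infinity[OF order_refl] eventually_at_infinity
proof (intro allI impI)
  fix r :: real assume "r > 0"
  show "\<exists>c. \<forall>t. c \<le> norm t \<longrightarrow> r \<le> norm (b + d * t)"
  proof (intro exI[of _ "(r + \<bar>b\<bar>) / \<bar>d\<bar>"] allI impI)
    fix t :: real assume "(r + \<bar>b\<bar>) / \<bar>d\<bar> \<le> norm t"
    then have "r + \<bar>b\<bar> \<le> \<bar>d * t\<bar>" using assms by (simp add: field_simps abs_mult)
    then show "r \<le> norm (b + d * t)" by (simp add: abs_if split: if_splits)
  qed
qed

text \<open>The shift by \<open>b\<close> changes \<open>|t|\<close> by a bounded amount, hence the exponential by a bounded factor.\<close>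

lemma envelope_affine_bigtheta:
  assumes "d \<noteq> 0"
  shows "(\<lambda>t. envelope 1 e (b + d * t)) \<in> \<Theta>[at_infinity](envelope \<bar>d\<bar> e)"
proof -
  have 1: "(\<lambda>t. \<bar>b + d * t\<bar> powr e) \<in> \<Theta>[at_infinity](\<lambda>t. \<bar>t\<bar> powr e)"
    using bigtheta_powr[OF affine_bigtheta[OF assms, of b], of e] by simp
  have 2: "(\<lambda>t. exp (- (pi / 2 * \<bar>b + d * t\<bar>))) \<in> \<Theta>[at_infinity](\<lambda>t. exp (- (pi / 2 * \<bar>d\<bar> * \<bar>t\<bar>)))"
  proof (rule bigthetaI)
    have a: "\<bar>\<bar>b + d * t\<bar> - \<bar>d\<bar> * \<bar>t\<bar>\<bar> \<le> \<bar>b\<bar>" for t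
      by (subst abs_mult[symmetric]) linarith
    have "pi / 2 * \<bar>b + d * t\<bar> \<le> pi / 2 * \<bar>b\<bar> + pi / 2 * \<bar>d\<bar> * \<bar>t\<bar>" for t
      using mult_left_mono[of "\<bar>b + d * t\<bar>" "\<bar>b\<bar> + \<bar>d\<bar> * \<bar>t\<bar>" "pi / 2"] a[of t] by (simp add: algebra_simps)
    then have "exp (- (pi / 2 * \<bar>b\<bar>)) * exp (- (pi / 2 * \<bar>d\<bar> * \<bar>t\<bar>)) \<le> exp (- (pi / 2 * \<bar>b + d * t\<bar>))" for t
      unfolding exp_add[symmetric] exp_le_cancel_iff by (smt (verit))
    then show "(\<lambda>t. exp (- (pi / 2 * \<bar>b + d * t\<bar>))) \<in> \<Omega>[at_infinity](\<lambda>t. exp (- (pi / 2 * \<bar>d\<bar> * \<bar>t\<bar>)))"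
      by (intro landau_omega.bigI[of "exp (- (pi / 2 * \<bar>b\<bar>))"] always_eventually) auto
    have "pi / 2 * \<bar>d\<bar> * \<bar>t\<bar> \<le> pi / 2 * \<bar>b\<bar> + pi / 2 * \<bar>b + d * t\<bar>" for t
      using mult_left_mono[of "\<bar>d\<bar> * \<bar>t\<bar>" "\<bar>b\<bar> + \<bar>b + d * t\<bar>" "pi / 2"] a[of t] by (simp add: algebra_simps)
    then have "exp (- (pi / 2 * \<bar>b + d * t\<bar>)) \<le> exp (pi / 2 * \<bar>b\<bar>) * exp (- (pi / 2 * \<bar>d\<bar> * \<bar>t\<bar>))" for t
      unfolding exp_add[symmetric] exp_le_cancel_iff by (smt (verit))
    then show "(\<lambda>t. exp (- (pi / 2 * \<bar>b + d * t\<bar>))) \<in> O[at_infinity](\<lambda>t. exp (- (pi / 2 * \<bar>d\<bar> * \<bar>t\<bar>)))"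
      by (intro bigoI[of _ "exp (pi / 2 * \<bar>b\<bar>)"] always_eventually) auto
  qed
  show ?thesis using landau_theta.mult[OF 1 2] by (simp add: envelope_def[abs_def])
qed

lemma norm_Gamma_line_bigtheta:
  assumes "d \<noteq> 0"
  shows "(\<lambda>t. norm (Gamma (c + of_real d * (\<i> * of_real t)))) \<in> \<Theta>[at_infinity](envelope \<bar>d\<bar> (Re c - 1/2))"
proof -
  have "c + of_real d * (\<i> * of_real t) = Complex (Re c) (Im c + d * t)" for t
    by (simp add: complex_eq_iff)
  then have "(\<lambda>t. norm (Gamma (c + of_real d * (\<i> * of_real t)))) \<in> \<Theta>[at_infinity](\<lambda>t. envelope 1 (Re c - 1/2) (Im c + d * t))"
    using landau_theta.compose[OF norm_Gamma_vertical_bigtheta filterlim_affine_at_infinity[OF assms], of "Re c" "Im c"]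
    by simp
  also note envelope_affine_bigtheta[OF assms]
  finally show ?thesis .
qed

section \<open>The integrand of the I-function\<close>

definition Gamma_prod ::
    "(complex \<Rightarrow> real \<Rightarrow> real \<Rightarrow> complex \<Rightarrow> complex) \<Rightarrow> I_triple list \<Rightarrow> complex \<Rightarrow> complex" where
  "Gamma_prod L xs s = (\<Prod>(c, d, \<kappa>)\<leftarrow>xs. Gamma_pow L c d \<kappa> s)"

lemma Gamma_prod_simps [simp]:
  "Gamma_prod L [] s = 1"
  "Gamma_prod L ((c, d, \<kappa>) # xs) s = Gamma_pow L c d \<kappa> s * Gamma_prod L xs s"
  by (simp_all add: Gamma_prod_def)

text \<open>With this reflection the numerator and the denominator of \<open>\<chi>\<close> become products of one shape.\<close>

definition reflect_triple :: "I_triple \<Rightarrow> I_triple" where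
  "reflect_triple = (\<lambda>(c, d, \<kappa>). (1 - c, - d, \<kappa>))"

lemma I_chi_eq:
  "I_chi L m n up lo s =
     Gamma_prod L (take m lo @ map reflect_triple (take n up)) s /
     Gamma_prod L (map reflect_triple (drop m lo) @ drop n up) s"
  by (simp add: I_chi_def Gamma_prod_def reflect_triple_def o_def case_prod_beta')

text \<open>The modulus does not depend on the branch. At a pole both sides are \<open>0\<close>, by the convention for
  \<open>\<Gamma>\<close> at its poles.\<close>

lemma norm_Gamma_pow:
  assumes "Gamma_log_branches L"
  shows "norm (Gamma_pow L c d \<kappa> (\<i> * of_real t)) = norm (Gamma (c + of_real d * (\<i> * of_real t))) powr \<kappa>"
proof (cases "c + of_real d * (\<i> * of_real t) \<in> \<int>\<^sub>\<le>\<^sub>0")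
  case True
  then have "Gamma (c + of_real d * (\<i> * of_real t)) = 0" by (simp add: Gamma_eq_zero_iff)
  with True show ?thesis by (simp add: Gamma_pow_def)
next
  case False
  have "\<i> * of_real t \<in> I_contour" by (simp add: I_contour_def)
  then have "exp (L c d \<kappa> (\<i> * of_real t)) = Gamma (c + of_real d * (\<i> * of_real t))"
    using assms False by (simp add: Gamma_log_branches_def)
  then have "norm (Gamma (c + of_real d * (\<i> * of_real t))) = exp (Re (L c d \<kappa> (\<i> * of_real t)))"
    by (metis norm_exp_eq_Re)
  then show ?thesis using False by (simp add: Gamma_pow_def exp_powr_real mult.commute)
qed

text \<open>A branch is continuous off the poles, which form a closed set.\<close>

lemma Gamma_pow_measurable [measurable]:
  assumes "Gamma_log_branches L"
  shows "(\<lambda>t. Gamma_pow L c d \<kappa> (\<i> * of_real t)) \<in> borel_measurable borel"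
proof -
  define U where "U = (\<lambda>t. c + of_real d * (\<i> * of_real t)) -` (- \<int>\<^sub>\<le>\<^sub>0)"
  have "open U"
    unfolding U_def by (intro open_vimage open_Compl closed_nonpos_Ints continuous_intros)
  have "continuous_on U (\<lambda>t. L c d \<kappa> (\<i> * of_real t))"
  proof (rule continuous_on_compose2[where g = "L c d \<kappa>" and f = "\<lambda>t. \<i> * of_real t"])
    show "continuous_on {s \<in> I_contour. c + of_real d * s \<notin> \<int>\<^sub>\<le>\<^sub>0} (L c d \<kappa>)"
      using assms by (simp add: Gamma_log_branches_def)
    show "continuous_on U (\<lambda>t. \<i> * of_real t)" by (intro continuous_intros)
    show "(\<lambda>t. \<i> * of_real t) ` U \<subseteq> {s \<in> I_contour. c + of_real d * s \<notin> \<int>\<^sub>\<le>\<^sub>0}"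
      by (auto simp: U_def I_contour_def)
  qed
  then have "continuous_on U (\<lambda>t. exp (of_real \<kappa> * L c d \<kappa> (\<i> * of_real t)))"
    by (intro continuous_intros)
  then have "(\<lambda>t. indicator U t *\<^sub>R exp (of_real \<kappa> * L c d \<kappa> (\<i> * of_real t))) \<in> borel_measurable borel"
    using \<open>open U\<close> by (intro borel_measurable_continuous_on_indicator) auto
  also have "(\<lambda>t. indicator U t *\<^sub>R exp (of_real \<kappa> * L c d \<kappa> (\<i> * of_real t))) = (\<lambda>t. Gamma_pow L c d \<kappa> (\<i> * of_real t))"
    by (auto simp: fun_eq_iff U_def Gamma_pow_def)
  finally show ?thesis .
qed

lemma Gamma_prod_measurable [measurable]:
  assumes "Gamma_log_branches L"
  shows "(\<lambda>t. Gamma_prod L xs (\<i> * of_real t)) \<in> borel_measurable borel"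
proof (induction xs)
  case (Cons x xs)
  obtain c d \<kappa> where "x = (c, d, \<kappa>)" by (cases x)
  with Cons Gamma_pow_measurable[OF assms] show ?case by simp
qed simp

lemma I_chi_measurable:
  assumes "Gamma_log_branches L"
  shows "(\<lambda>t. I_chi L m n up lo (\<i> * of_real t)) \<in> borel_measurable borel"
  unfolding I_chi_eq using Gamma_prod_measurable[OF assms] by (intro borel_measurable_divide)

lemma Gamma_prod_bigtheta:
  assumes L: "Gamma_log_branches L" and nz: "\<forall>(c, d, \<kappa>) \<in> set xs. d \<noteq> 0"
  shows "(\<lambda>t. norm (Gamma_prod L xs (\<i> * of_real t))) \<in>
    \<Theta>[at_infinity](envelope (\<Sum>(c, d, \<kappa>)\<leftarrow>xs. \<kappa> * \<bar>d\<bar>) (\<Sum>(c, d, \<kappa>)\<leftarrow>xs. \<kappa> * (Re c - 1/2)))"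
  using nz
proof (induction xs)
  case Nil
  show ?case
    by (intro bigthetaI_cong eventually_mono[OF eventually_nz_at_infinity]) (simp add: envelope_def)
next
  case (Cons x xs)
  obtain c d \<kappa> where x: "x = (c, d, \<kappa>)" by (cases x)
  have "(\<lambda>t. \<bar>norm (Gamma (c + of_real d * (\<i> * of_real t)))\<bar> powr \<kappa>) \<in> \<Theta>[at_infinity](\<lambda>t. \<bar>envelope \<bar>d\<bar> (Re c - 1/2) t\<bar> powr \<kappa>)"
    using Cons.prems x by (intro bigtheta_powr norm_Gamma_line_bigtheta) auto
  then have "(\<lambda>t. norm (Gamma_pow L c d \<kappa> (\<i> * of_real t))) \<in> \<Theta>[at_infinity](envelope (\<kappa> * \<bar>d\<bar>) (\<kappa> * (Re c - 1/2)))"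
    by (simp add: norm_Gamma_pow[OF L] abs_of_nonneg[OF envelope_nonneg] envelope_powr)
  from landau_theta.mult[OF this Cons.IH] Cons.prems show ?case
    by (simp add: x norm_mult envelope_mult)
qed

lemma sum_list_take_drop: "(\<Sum>x\<leftarrow>xs. f x) = (\<Sum>x\<leftarrow>take n xs. f x) + (\<Sum>x\<leftarrow>drop n xs. f x :: real)"
  by (metis append_take_drop_id map_append sum_list_append)

text \<open>The exponents \<open>I_Delta\<close> and \<open>I_Omega\<close> are the ones that result from multiplying the estimates of
  the single Gamma factors. Reflecting a triple keeps \<open>\<kappa>|d|\<close> and changes the sign of \<open>\<kappa>(Re c - 1/2)\<close>;
  therefore upper and lower triples enter \<open>I_Omega\<close> irrespective of their position in the quotient.\<close>

lemma I_chi_bigtheta: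
  assumes L: "Gamma_log_branches L"
    and up: "\<forall>(a, A, \<kappa>) \<in> set up. A > 0 \<and> \<kappa> > 0" and lo: "\<forall>(b, B, \<kappa>) \<in> set lo. B > 0 \<and> \<kappa> > 0"
  shows "(\<lambda>t. norm (I_chi L m n up lo (\<i> * of_real t))) \<in> \<Theta>[at_infinity](envelope (I_Delta m n up lo) (I_Omega up lo))"
proof -
  let ?num = "take m lo @ map reflect_triple (take n up)"
  let ?den = "map reflect_triple (drop m lo) @ drop n up"
  have quotient: "(\<lambda>t. f t / h t) \<in> \<Theta>[F](\<lambda>t. g t / k t)"
    if "f \<in> \<Theta>[F](g)" "h \<in> \<Theta>[F](k)" for f g h k :: "real \<Rightarrow> real" and F
    using that by (simp add: divide_inverse landau_theta.mult)
  define D where "D xs = (\<Sum>(c, d, \<kappa>)\<leftarrow>xs. \<kappa> * \<bar>d\<bar>)" for xs :: "I_triple list"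
  define E where "E xs = (\<Sum>(c, d, \<kappa>)\<leftarrow>xs. \<kappa> * (Re c - 1/2))" for xs :: "I_triple list"
  have Dapp: "D (xs @ ys) = D xs + D ys" and Eapp: "E (xs @ ys) = E xs + E ys" for xs ys
    by (simp_all add: D_def E_def)
  have Drefl: "D (map reflect_triple xs) = D xs" for xs
    by (induction xs) (auto simp: D_def reflect_triple_def)
  have Erefl: "E (map reflect_triple xs) = - E xs" for xs
    by (induction xs) (auto simp: E_def reflect_triple_def algebra_simps)
  have Dpos: "D xs = (\<Sum>(c, d, \<kappa>)\<leftarrow>xs. \<kappa> * d)" if "set xs \<subseteq> set ys" "\<forall>(c, d, \<kappa>) \<in> set ys. d > 0 \<and> \<kappa> > 0" for xs ys
    unfolding D_def using that by (intro arg_cong[of _ _ sum_list] map_cong refl) fastforce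
  have nz: "\<forall>(c, d, \<kappa>) \<in> set ?num. d \<noteq> 0" "\<forall>(c, d, \<kappa>) \<in> set ?den. d \<noteq> 0"
    using up lo by (auto simp: reflect_triple_def dest!: in_set_takeD in_set_dropD)
  have "(\<lambda>t. norm (I_chi L m n up lo (\<i> * of_real t))) \<in> \<Theta>[at_infinity](\<lambda>t. envelope (D ?num) (E ?num) t / envelope (D ?den) (E ?den) t)"
    unfolding I_chi_eq norm_divide D_def E_def
    by (intro quotient Gamma_prod_bigtheta L nz)
  moreover have "D ?num - D ?den = I_Delta m n up lo"
    unfolding Dapp Drefl I_Delta_def
    by (simp add: Dpos[OF set_take_subset up] Dpos[OF set_take_subset lo] Dpos[OF set_drop_subset up] Dpos[OF set_drop_subset lo])
  moreover have "E ?num - E ?den = E lo - E up"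
    unfolding Eapp Erefl by (simp add: E_def sum_list_take_drop[of _ up n] sum_list_take_drop[of _ lo m])
  moreover have "E xs = - (\<Sum>(a, A, \<kappa>)\<leftarrow>xs. (1/2 - Re a) * \<kappa>)" for xs
    unfolding E_def by (induction xs) (auto simp: algebra_simps)
  then have "E lo - E up = I_Omega up lo" by (simp add: I_Omega_def)
  ultimately show ?thesis by (simp add: envelope_divide)
qed

text \<open>The branches need not be continuous across poles of denominator factors, but the modulus is
  continuous everywhere: it is a product of positive powers of \<open>|\<Gamma>|\<close> for the numerator, where the
  separation condition excludes poles, and of \<open>|1/\<Gamma>|\<close> for the denominator.\<close>

lemma norm_I_chi_continuous:
  assumes L: "Gamma_log_branches L"
    and up: "\<forall>(a, A, \<kappa>) \<in> set up. A > 0 \<and> \<kappa> > 0" and lo: "\<forall>(b, B, \<kappa>) \<in> set lo. B > 0 \<and> \<kappa> > 0"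
    and sep: "I_separated m n up lo"
  shows "continuous_on UNIV (\<lambda>t. norm (I_chi L m n up lo (\<i> * of_real t)))"
proof -
  have line: "continuous_on UNIV (\<lambda>t. c + of_real d * (\<i> * of_real t))" for c :: complex and d
    by (intro continuous_intros)
  have num: "continuous_on UNIV (\<lambda>t. norm (Gamma_prod L xs (\<i> * of_real t)))"
    if "\<forall>(c, d, \<kappa>) \<in> set xs. \<kappa> > 0 \<and> (\<forall>s. c + of_real d * s \<in> \<int>\<^sub>\<le>\<^sub>0 \<longrightarrow> Re s \<noteq> 0)" for xs
    using that
  proof (induction xs)
    case (Cons x xs)
    obtain c d \<kappa> where x: "x = (c, d, \<kappa>)" by (cases x)
    have "c + of_real d * (\<i> * of_real t) \<notin> \<int>\<^sub>\<le>\<^sub>0" for t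
      using Cons.prems x by fastforce
    then have "continuous_on UNIV (\<lambda>t. Gamma (c + of_real d * (\<i> * of_real t)))"
      by (intro continuous_on_compose2[OF continuous_on_Gamma[of "- \<int>\<^sub>\<le>\<^sub>0"] line]) auto
    moreover have "\<kappa> > 0" using Cons.prems x by auto
    ultimately have "continuous_on UNIV (\<lambda>t. norm (Gamma_pow L c d \<kappa> (\<i> * of_real t)))"
      unfolding norm_Gamma_pow[OF L]
      by (intro continuous_on_powr' continuous_on_norm continuous_on_const) auto
    moreover have "continuous_on UNIV (\<lambda>t. norm (Gamma_prod L xs (\<i> * of_real t)))"
      using Cons by auto
    ultimately show ?case by (simp add: x norm_mult continuous_on_mult)
  qed simp
  have den: "continuous_on UNIV (\<lambda>t. inverse (norm (Gamma_prod L xs (\<i> * of_real t))))"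
    if "\<forall>(c, d, \<kappa>) \<in> set xs. \<kappa> > 0" for xs
    using that
  proof (induction xs)
    case (Cons x xs)
    obtain c d \<kappa> where x: "x = (c, d, \<kappa>)" by (cases x)
    have "\<kappa> > 0" using Cons.prems x by auto
    have "inverse (norm (Gamma_pow L c d \<kappa> (\<i> * of_real t))) = norm (rGamma (c + of_real d * (\<i> * of_real t))) powr \<kappa>" for t
      by (simp add: norm_Gamma_pow[OF L] rGamma_inverse_Gamma norm_inverse inverse_powr)
    moreover have "continuous_on UNIV (\<lambda>t. norm (rGamma (c + of_real d * (\<i> * of_real t))) powr \<kappa>)"
    proof (intro continuous_on_powr' continuous_on_norm continuous_on_const)
      show "continuous_on UNIV (\<lambda>t. rGamma (c + of_real d * (\<i> * of_real t)))"
        by (rule continuous_on_compose2[OF continuous_on_rGamma[of UNIV] line]) simp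
    qed (use \<open>\<kappa> > 0\<close> in simp)
    ultimately have "continuous_on UNIV (\<lambda>t. inverse (norm (Gamma_pow L c d \<kappa> (\<i> * of_real t))))" by simp
    moreover have "continuous_on UNIV (\<lambda>t. inverse (norm (Gamma_prod L xs (\<i> * of_real t))))"
      using Cons by auto
    ultimately show ?case by (simp add: x norm_mult continuous_on_mult)
  qed simp
  have "continuous_on UNIV (\<lambda>t. norm (Gamma_prod L (take m lo @ map reflect_triple (take n up)) (\<i> * of_real t)) *
      inverse (norm (Gamma_prod L (map reflect_triple (drop m lo) @ drop n up) (\<i> * of_real t))))"
  proof (intro continuous_on_mult num den)
    show "\<forall>(c, d, \<kappa>)\<in>set (take m lo @ map reflect_triple (take n up)). \<kappa> > 0 \<and> (\<forall>s. c + of_real d * s \<in> \<int>\<^sub>\<le>\<^sub>0 \<longrightarrow> Re s \<noteq> 0)"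
    proof (intro ballI, clarify, rename_tac c d \<kappa>)
      fix c d \<kappa> assume "(c, d, \<kappa>) \<in> set (take m lo @ map reflect_triple (take n up))"
      then consider "(c, d, \<kappa>) \<in> set (take m lo)" | "(1 - c, - d, \<kappa>) \<in> set (take n up)"
        by (auto simp: reflect_triple_def)
      then show "\<kappa> > 0 \<and> (\<forall>s. c + of_real d * s \<in> \<int>\<^sub>\<le>\<^sub>0 \<longrightarrow> Re s \<noteq> 0)"
      proof cases
        case 1
        then have "\<forall>s. c + of_real d * s \<in> \<int>\<^sub>\<le>\<^sub>0 \<longrightarrow> Re s < 0"
          using sep unfolding I_separated_def by blast
        moreover have "\<kappa> > 0" using bspec[OF lo in_set_takeD[OF 1]] by simp
        ultimately show ?thesis by force
      next
        case 2
        then have "\<forall>s. 1 - (1 - c) - of_real (- d) * s \<in> \<int>\<^sub>\<le>\<^sub>0 \<longrightarrow> Re s > 0"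
          using sep unfolding I_separated_def by blast
        moreover have "\<kappa> > 0" using bspec[OF up in_set_takeD[OF 2]] by simp
        ultimately show ?thesis by force
      qed
    qed
    show "\<forall>(c, d, \<kappa>)\<in>set (map reflect_triple (drop m lo) @ drop n up). \<kappa> > 0"
      using up lo by (auto simp: reflect_triple_def dest!: in_set_dropD)
  qed
  then show ?thesis by (simp add: I_chi_eq norm_mult norm_inverse divide_inverse)
qed

lemma integrable_continuous_bigo_powr:
  fixes f :: "real \<Rightarrow> real"
  assumes cont: "continuous_on UNIV f" and bigo: "f \<in> O[at_infinity](\<lambda>t. \<bar>t\<bar> powr w)" and w: "w < -1"
  shows "integrable lborel f"
proof -
  obtain C where C: "C > 0" "\<forall>\<^sub>F t in at_infinity. norm (f t) \<le> C * norm (\<bar>t\<bar> powr w)"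
    using bigo by (rule landau_o.bigE)
  then obtain T0 where T0: "\<And>t. T0 \<le> \<bar>t\<bar> \<Longrightarrow> \<bar>f t\<bar> \<le> C * \<bar>t\<bar> powr w"
    by (auto simp: eventually_at_infinity)
  define T where "T = max T0 1"
  have T: "T > 0" "\<And>t. T \<le> \<bar>t\<bar> \<Longrightarrow> \<bar>f t\<bar> \<le> C * \<bar>t\<bar> powr w" using T0 by (auto simp: T_def)
  have tail: "set_integrable lborel {T..} (\<lambda>t. t powr w)"
  proof -
    have "(\<lambda>t. t powr w) absolutely_integrable_on {T..}"
      using has_integral_powr_to_inf[OF w T(1)] by (intro nonnegative_absolutely_integrable_1) (auto simp: integrable_on_def)
    then show ?thesis
      by (simp add: absolutely_integrable_on_def set_integrable_def integrable_completion)
  qed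
  have 1: "integrable lborel (\<lambda>t. indicator {T..} t *\<^sub>R t powr w)" using tail by (simp add: set_integrable_def)
  have 2: "integrable lborel (\<lambda>t. indicator {T..} (-t) *\<^sub>R (-t) powr w)"
    using lborel_integrable_real_affine[OF 1, of "-1" 0] by simp
  have 3: "integrable lborel (\<lambda>t. indicator {-T..T} t *\<^sub>R \<bar>f t\<bar>)"
    using borel_integrable_atLeastAtMost'[of "-T" T "\<lambda>t. \<bar>f t\<bar>"] continuous_on_subset[OF cont, of "{-T..T}"]
    by (simp add: set_integrable_def continuous_on_rabs)
  show ?thesis
  proof (rule Bochner_Integration.integrable_bound)
    show "integrable lborel (\<lambda>t. indicator {-T..T} t *\<^sub>R \<bar>f t\<bar> + (C * (indicator {T..} t *\<^sub>R t powr w) + C * (indicator {T..} (-t) *\<^sub>R (-t) powr w)))"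
      using 1 2 3 by (intro Bochner_Integration.integrable_add integrable_mult_right) auto
    show "f \<in> borel_measurable lborel" using cont borel_measurable_continuous_onI by simp
    show "AE t in lborel. norm (f t) \<le> norm (indicator {-T..T} t *\<^sub>R \<bar>f t\<bar> + (C * (indicator {T..} t *\<^sub>R t powr w) + C * (indicator {T..} (-t) *\<^sub>R (-t) powr w)))"
    proof (intro AE_I2)
      fix t
      have nn: "0 \<le> C * (indicator {T..} t *\<^sub>R t powr w)" "0 \<le> C * (indicator {T..} (-t) *\<^sub>R (-t) powr w)" "0 \<le> indicator {-T..T} t *\<^sub>R \<bar>f t\<bar>"
        using C(1) by auto
      have "\<bar>f t\<bar> \<le> indicator {-T..T} t *\<^sub>R \<bar>f t\<bar> + (C * (indicator {T..} t *\<^sub>R t powr w) + C * (indicator {T..} (-t) *\<^sub>R (-t) powr w))"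
      proof -
        consider "\<bar>t\<bar> \<le> T" | "t > T" | "t < -T" by linarith
        then show ?thesis
        proof cases
          case 1
          then have "t \<in> {-T..T}" by auto
          then show ?thesis using nn by simp
        next
          case 2 then show ?thesis using nn T(1) T(2)[of t] by auto
        next
          case 3 then show ?thesis using nn T(1) T(2)[of t] by auto
        qed
      qed
      then show "norm (f t) \<le> norm (indicator {-T..T} t *\<^sub>R \<bar>f t\<bar> + (C * (indicator {T..} t *\<^sub>R t powr w) + C * (indicator {T..} (-t) *\<^sub>R (-t) powr w)))"
        by simp
    qed
  qed
qed

lemma filterlim_abs_at_infinity: "filterlim (\<lambda>t::real. \<bar>t\<bar>) at_top at_infinity"
  using filterlim_norm_at_top[where 'a=real] unfolding real_norm_def[abs_def] .

text \<open>The modulus of the integrand is continuous and of order at most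
  \<open>|t|\<^sup>\<Omega> exp (- (\<pi>\<Delta>/2 - |\<theta>|) |t|)\<close>. This is integrable at infinity if the exponential rate is positive, and
  also if it vanishes and \<open>\<Omega> < -1\<close>; these are the alternatives of \<open>I_convergent\<close> on the imaginary
  axis.\<close>

theorem I_integrand_integrable:
  assumes L: "Gamma_log_branches L"
    and up: "\<forall>(a, A, \<kappa>) \<in> set up. A > 0 \<and> \<kappa> > 0" and lo: "\<forall>(b, B, \<kappa>) \<in> set lo. B > 0 \<and> \<kappa> > 0"
    and sep: "I_separated m n up lo" and conv: "I_convergent m n up lo \<theta>"
  shows "integrable lborel (\<lambda>t. I_chi L m n up lo (\<i> * of_real t) * exp (- (\<i> * of_real t) * (of_real l + \<i> * of_real \<theta>)))"
proof -
  define D where "D = I_Delta m n up lo"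
  define W where "W = I_Omega up lo"
  define f where "f t = norm (I_chi L m n up lo (\<i> * of_real t)) * exp (\<theta> * t)" for t
  have cont: "continuous_on UNIV f" unfolding f_def
    by (intro continuous_on_mult norm_I_chi_continuous assms continuous_intros)
  have fO: "f \<in> O[at_infinity](\<lambda>t. \<bar>t\<bar> powr W * exp (- (pi / 2 * D - \<bar>\<theta>\<bar>) * \<bar>t\<bar>))"
  proof -
    have "(\<lambda>t. exp (\<theta> * t)) \<in> O[at_infinity](\<lambda>t. exp (\<bar>\<theta>\<bar> * \<bar>t\<bar>))"
      by (intro bigoI[of _ 1] always_eventually) (auto simp flip: abs_mult)
    with I_chi_bigtheta[OF L up lo, of m n] have "f \<in> O[at_infinity](\<lambda>t. envelope D W t * exp (\<bar>\<theta>\<bar> * \<bar>t\<bar>))"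
      unfolding f_def D_def W_def by (intro landau_o.big.mult[OF bigthetaD1])
    also have "(\<lambda>t. envelope D W t * exp (\<bar>\<theta>\<bar> * \<bar>t\<bar>)) = (\<lambda>t. \<bar>t\<bar> powr W * exp (- (pi / 2 * D - \<bar>\<theta>\<bar>) * \<bar>t\<bar>))"
      by (auto simp: envelope_def fun_eq_iff algebra_simps simp flip: exp_add)
    finally show ?thesis .
  qed
  have "\<exists>w < -1. f \<in> O[at_infinity](\<lambda>t. \<bar>t\<bar> powr w)"
  proof (cases "\<bar>\<theta>\<bar> < pi / 2 * D")
    case True
    define \<delta> where "\<delta> = pi / 2 * D - \<bar>\<theta>\<bar>"
    have "\<delta> > 0" using True by (simp add: \<delta>_def)
    then have "(\<lambda>x. x powr W * exp (- \<delta> * x)) \<in> O(\<lambda>x. x powr (-2))" by real_asymp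
    then have "(\<lambda>t. \<bar>t\<bar> powr W * exp (- \<delta> * \<bar>t\<bar>)) \<in> O[at_infinity](\<lambda>t. \<bar>t\<bar> powr (-2))"
      by (rule landau_o.big.compose[OF _ filterlim_abs_at_infinity])
    with fO have "f \<in> O[at_infinity](\<lambda>t. \<bar>t\<bar> powr (-2))"
      unfolding \<delta>_def by (rule landau_o.big_trans)
    then show ?thesis by (intro exI[of _ "-2"]) auto
  next
    case False
    have "0 \<in> I_contour" by (simp add: I_contour_def)
    with conv False have \<theta>: "\<bar>\<theta>\<bar> = pi / 2 * D" and W: "W < -1"
      unfolding I_convergent_def D_def W_def by (auto dest: bspec[of _ _ 0])
    have "pi / 2 * D - \<bar>\<theta>\<bar> = 0" using \<theta> by simp
    from fO[unfolded this] show ?thesis using W by (intro exI[of _ W]) simp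
  qed
  then have "integrable lborel f" using integrable_continuous_bigo_powr[OF cont] by blast
  then show ?thesis
  proof (rule Bochner_Integration.integrable_bound)
    show "(\<lambda>t. I_chi L m n up lo (\<i> * of_real t) * exp (- (\<i> * of_real t) * (of_real l + \<i> * of_real \<theta>))) \<in> borel_measurable lborel"
      using I_chi_measurable[OF L] by measurable
    show "AE t in lborel. norm (I_chi L m n up lo (\<i> * of_real t) * exp (- (\<i> * of_real t) * (of_real l + \<i> * of_real \<theta>))) \<le> norm (f t)"
      by (intro AE_I2) (simp add: f_def norm_mult mult.commute)
  qed
qed

section \<open>Differentiation under the integral sign\<close>

text \<open>Dominated convergence for the difference quotients, which the mean value inequality bounds by \<open>g\<close>.\<close>

lemma has_vector_derivative_integral:
  fixes f f' :: "real \<Rightarrow> 'a \<Rightarrow> 'b::{banach, second_countable_topology}"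
  assumes x: "a < x" "x < b"
    and int: "\<And>y. a < y \<Longrightarrow> y < b \<Longrightarrow> integrable M (f y)"
    and deriv: "\<And>y t. a < y \<Longrightarrow> y < b \<Longrightarrow> t \<in> space M \<Longrightarrow> ((\<lambda>y. f y t) has_vector_derivative f' y t) (at y)"
    and bound: "\<And>y t. a < y \<Longrightarrow> y < b \<Longrightarrow> t \<in> space M \<Longrightarrow> norm (f' y t) \<le> g t"
    and g: "integrable M g" and meas: "f' x \<in> borel_measurable M"
  shows "((\<lambda>y. \<integral>t. f y t \<partial>M) has_vector_derivative (\<integral>t. f' x t \<partial>M)) (at x)"
proof -
  (* Restricting the limit to the interval lets sequences witness it without leaving the domain
     of the hypotheses. *)
  have quot: "((\<lambda>y. (h y - h x) /\<^sub>R (y - x)) \<longlongrightarrow> v) (at x within {a<..<b}) \<longleftrightarrow> (h has_vector_derivative v) (at x)"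
    for h :: "real \<Rightarrow> 'b" and v
  proof -
    have "(h has_vector_derivative v) (at x) \<longleftrightarrow> (h has_vector_derivative v) (at x within {a<..<b})"
      using x by (simp add: has_vector_derivative_within_open[of x "{a<..<b}"])
    also have "\<dots> \<longleftrightarrow> ((\<lambda>y. norm (h y - h x - (y - x) *\<^sub>R v) / norm (y - x)) \<longlongrightarrow> 0) (at x within {a<..<b})"
      unfolding has_vector_derivative_def has_derivative_iff_norm
      by (simp add: bounded_linear_scaleR_left)
    also have "\<dots> \<longleftrightarrow> ((\<lambda>y. norm ((h y - h x) /\<^sub>R (y - x) - v)) \<longlongrightarrow> 0) (at x within {a<..<b})"
    proof (rule tendsto_cong)
      have "norm (h y - h x - (y - x) *\<^sub>R v) / norm (y - x) = norm ((h y - h x) /\<^sub>R (y - x) - v)" if "y \<noteq> x" for y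
      proof -
        have "(h y - h x) /\<^sub>R (y - x) - v = (h y - h x - (y - x) *\<^sub>R v) /\<^sub>R (y - x)"
          using that by (simp add: scaleR_diff_right)
        then show ?thesis by (simp add: divide_inverse mult.commute)
      qed
      then show "\<forall>\<^sub>F y in at x within {a<..<b}. norm (h y - h x - (y - x) *\<^sub>R v) / norm (y - x) = norm ((h y - h x) /\<^sub>R (y - x) - v)"
        by (auto simp: eventually_at_filter)
    qed
    also have "\<dots> \<longleftrightarrow> ((\<lambda>y. (h y - h x) /\<^sub>R (y - x)) \<longlongrightarrow> v) (at x within {a<..<b})"
      by (simp add: tendsto_norm_zero_iff LIM_zero_iff)
    finally show ?thesis by simp
  qed
  have "((\<lambda>y. ((\<integral>t. f y t \<partial>M) - (\<integral>t. f x t \<partial>M)) /\<^sub>R (y - x)) \<longlongrightarrow> (\<integral>t. f' x t \<partial>M)) (at x within {a<..<b})"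
    unfolding tendsto_at_iff_sequentially comp_def
  proof (intro allI impI)
    fix X assume X: "\<forall>i. X i \<in> {a<..<b} - {x}" "X \<longlonglongrightarrow> x"
    have Xi: "a < X i" "X i < b" "X i \<noteq> x" for i using X(1) by auto
    have "(\<lambda>i. \<integral>t. (f (X i) t - f x t) /\<^sub>R (X i - x) \<partial>M) \<longlonglongrightarrow> (\<integral>t. f' x t \<partial>M)"
    proof (rule integral_dominated_convergence[where w = g])
      show "(\<lambda>t. (f (X i) t - f x t) /\<^sub>R (X i - x)) \<in> borel_measurable M" for i
        using int[OF Xi(1,2), of i] int[OF x] by measurable
      show "AE t in M. (\<lambda>i. (f (X i) t - f x t) /\<^sub>R (X i - x)) \<longlonglongrightarrow> f' x t"
      proof (rule AE_I2)
        fix t assume "t \<in> space M"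
        from deriv[OF x this] have "((\<lambda>y. (f y t - f x t) /\<^sub>R (y - x)) \<longlongrightarrow> f' x t) (at x within {a<..<b})"
          by (rule quot[of "\<lambda>y. f y t" "f' x t", THEN iffD2])
        then show "(\<lambda>i. (f (X i) t - f x t) /\<^sub>R (X i - x)) \<longlonglongrightarrow> f' x t"
          using X unfolding tendsto_at_iff_sequentially comp_def by blast
      qed
      show "AE t in M. norm ((f (X i) t - f x t) /\<^sub>R (X i - x)) \<le> g t" for i
      proof (rule AE_I2)
        fix t assume t: "t \<in> space M"
        have "norm (f (X i) t - f x t) \<le> g t * norm (X i - x)"
        proof (rule differentiable_bound[where S = "{a<..<b}" and f' = "\<lambda>y h. h *\<^sub>R f' y t"])
          show "((\<lambda>y. f y t) has_derivative (\<lambda>h. h *\<^sub>R f' y t)) (at y within {a<..<b})" if "y \<in> {a<..<b}" for y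
            using deriv[of y t] that t by (auto simp: has_vector_derivative_def intro: has_derivative_at_withinI)
          show "onorm (\<lambda>h. h *\<^sub>R f' y t) \<le> g t" if "y \<in> {a<..<b}" for y
          proof (rule onorm_le)
            fix h :: real
            show "norm (h *\<^sub>R f' y t) \<le> g t * norm h"
              using mult_right_mono[OF bound[of y t], of "\<bar>h\<bar>"] that t by (simp add: mult.commute)
          qed
        qed (use Xi x in auto)
        then show "norm ((f (X i) t - f x t) /\<^sub>R (X i - x)) \<le> g t"
          using Xi(3)[of i] by (simp add: norm_scaleR pos_divide_le_eq flip: divide_inverse_commute)
      qed
    qed (fact meas g)+
    moreover have "(\<integral>t. (f (X i) t - f x t) /\<^sub>R (X i - x) \<partial>M) = ((\<integral>t. f (X i) t \<partial>M) - (\<integral>t. f x t \<partial>M)) /\<^sub>R (X i - x)" for i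
      using int[OF Xi(1,2), of i] int[OF x] by simp
    ultimately show "(\<lambda>i. ((\<integral>t. f (X i) t \<partial>M) - (\<integral>t. f x t \<partial>M)) /\<^sub>R (X i - x)) \<longlonglongrightarrow> (\<integral>t. f' x t \<partial>M)"
      by (simp only:)
  qed
  then show ?thesis by (rule quot[THEN iffD1])
qed

section \<open>The Saigo operators on Mellin integrals\<close>

text \<open>The Saigo kernel with parameters \<open>\<alpha>\<close>, \<open>\<beta>\<close>, \<open>\<gamma>\<close> is, up to its prefactor, the case \<open>a = \<alpha> + \<beta>\<close>, \<open>b = - \<gamma>\<close>, \<open>c = \<alpha>\<close>.\<close>

definition saigo_kernel :: "complex \<Rightarrow> complex \<Rightarrow> complex \<Rightarrow> real \<Rightarrow> real \<Rightarrow> complex" where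
  "saigo_kernel a b c x t = indicator {0<..<x} t *\<^sub>R
     (cpow (x - t) (c - 1) * hyp2F1 a b c (of_real (1 - t / x)))"

text \<open>The substitution \<open>t = x (1 - v)\<close> reduces this to the unit interval.\<close>

lemma saigo_kernel_power:
  assumes x: "x > 0" and c: "Re c > 0" and r: "Re r > 0" and s: "Re (r + c - a - b) > 0"
  shows "integrable lborel (\<lambda>t. saigo_kernel a b c x t * cpow t (r - 1))"
    and "(\<integral>t. saigo_kernel a b c x t * cpow t (r - 1) \<partial>lborel) =
      cpow x (c + r - 1) * (Gamma c * Gamma r * Gamma (r + c - a - b) * rGamma (r + c - a) * rGamma (r + c - b))"
proof -
  define h where "h v = indicator {0<..<1} v *\<^sub>R (cpow v (c - 1) * cpow (1 - v) (r - 1) * hyp2F1 a b c (of_real v))" for v :: real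
  have h: "integrable lborel h" "integral\<^sup>L lborel h = Gamma c * Gamma r * Gamma (r + c - a - b) * rGamma (r + c - a) * rGamma (r + c - b)"
    using hyp2F1_Beta_integral[OF c r s] unfolding h_def set_integrable_def set_lebesgue_integral_def by auto
  have eq: "saigo_kernel a b c x (x + (-x) * v) * cpow (x + (-x) * v) (r - 1) = cpow x (c - 1) * cpow x (r - 1) * h v" for v
  proof (cases "0 < v \<and> v < 1")
    case True
    have e1: "x + (-x) * v = x * (1 - v)" and e2: "x - x * (1 - v) = x * v" and e3: "1 - x * (1 - v) / x = v"
      using x by (simp_all add: field_simps)
    have "x * (1 - v) \<in> {0<..<x}" "v \<in> {0<..<1}" using x True by auto
    moreover have "cpow (x * v) (c - 1) = cpow x (c - 1) * cpow v (c - 1)"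
      "cpow (x * (1 - v)) (r - 1) = cpow x (r - 1) * cpow (1 - v) (r - 1)"
      using x True by (simp_all add: cpow_mult)
    ultimately show ?thesis
      unfolding saigo_kernel_def h_def e1 e2 e3 by (simp only: indicator_simps scaleR_one mult_ac)
  next
    case False
    have "\<not> (0 < x + (-x) * v \<and> x + (-x) * v < x)"
    proof
      assume "0 < x + (-x) * v \<and> x + (-x) * v < x"
      then have "x * v < x * 1" "x * 0 < x * v" by auto
      with x have "v < 1" "0 < v" by (auto simp only: mult_less_cancel_left_pos)
      with False show False by blast
    qed
    with False show ?thesis by (auto simp: saigo_kernel_def h_def)
  qed
  show "integrable lborel (\<lambda>t. saigo_kernel a b c x t * cpow t (r - 1))"
    using h(1) x lborel_integrable_real_affine_iff[of "-x" "\<lambda>t. saigo_kernel a b c x t * cpow t (r - 1)" x]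
    unfolding eq by simp
  have "(\<integral>t. saigo_kernel a b c x t * cpow t (r - 1) \<partial>lborel) = \<bar>-x\<bar> *\<^sub>R (\<integral>v. cpow x (c - 1) * cpow x (r - 1) * h v \<partial>lborel)"
    using x lborel_integral_real_affine[of "-x" "\<lambda>t. saigo_kernel a b c x t * cpow t (r - 1)" x]
    unfolding eq by simp
  also have "\<dots> = (of_real x * cpow x (c - 1) * cpow x (r - 1)) * integral\<^sup>L lborel h"
    using x by (simp add: scaleR_conv_of_real)
  also have "of_real x * cpow x (c - 1) * cpow x (r - 1) = cpow x (c + r - 1)"
    using cpow_add[of x 1 "c - 1"] cpow_add[of x c "r - 1"] cpow_of_nat[OF x, of 1] by (simp add: add_diff_eq)
  finally show "(\<integral>t. saigo_kernel a b c x t * cpow t (r - 1) \<partial>lborel) =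
      cpow x (c + r - 1) * (Gamma c * Gamma r * Gamma (r + c - a - b) * rGamma (r + c - a) * rGamma (r + c - b))"
    by (simp add: h(2))
qed

lemma norm_cpow_imaginary: "Re s = 0 \<Longrightarrow> norm (cpow t s) = 1"
  by (simp add: cpow_def)

text \<open>Since the power has modulus \<open>1\<close>, the modulus of the integrand is the product \<open>|K t| |W \<tau>|\<close>.\<close>

lemma Fubini_Mellin:
  fixes K W :: "real \<Rightarrow> complex" and u :: "real \<Rightarrow> complex"
  assumes K: "integrable lborel K" and W: "integrable lborel W"
    and u[measurable]: "u \<in> borel_measurable borel" and re: "\<And>\<tau>. Re (u \<tau>) = 0"
  shows "integrable lborel (\<lambda>t. K t * (\<integral>\<tau>. W \<tau> * cpow t (u \<tau>) \<partial>lborel))"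
    and "(\<integral>t. K t * (\<integral>\<tau>. W \<tau> * cpow t (u \<tau>) \<partial>lborel) \<partial>lborel) = (\<integral>\<tau>. W \<tau> * (\<integral>t. K t * cpow t (u \<tau>) \<partial>lborel) \<partial>lborel)"
proof -
  define F where "F t \<tau> = K t * (W \<tau> * cpow t (u \<tau>))" for t \<tau>
  have [measurable]: "K \<in> borel_measurable borel" "W \<in> borel_measurable borel" using K W by auto
  have nF: "norm (F t \<tau>) = norm (K t) * norm (W \<tau>)" for t \<tau>
    by (simp add: F_def norm_mult norm_cpow_imaginary re)
  have Wc: "integrable lborel (\<lambda>\<tau>. W \<tau> * cpow t (u \<tau>))" for t
    by (rule Bochner_Integration.integrable_bound[OF W]) (auto simp: norm_mult norm_cpow_imaginary re)
  have int: "integrable (lborel \<Otimes>\<^sub>M lborel) (case_prod F)"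
  proof (rule lborel_pair.Fubini_integrable)
    show "case_prod F \<in> borel_measurable (lborel \<Otimes>\<^sub>M lborel)" unfolding F_def by measurable
    show "integrable lborel (\<lambda>t. \<integral>\<tau>. norm (case (t, \<tau>) of (t, \<tau>) \<Rightarrow> F t \<tau>) \<partial>lborel)"
      using K by (simp add: nF)
    show "AE t in lborel. integrable lborel (\<lambda>\<tau>. case (t, \<tau>) of (t, \<tau>) \<Rightarrow> F t \<tau>)"
      using Wc by (simp add: F_def)
  qed
  have inner: "(\<integral>\<tau>. F t \<tau> \<partial>lborel) = K t * (\<integral>\<tau>. W \<tau> * cpow t (u \<tau>) \<partial>lborel)" for t
    by (simp add: F_def)
  show "integrable lborel (\<lambda>t. K t * (\<integral>\<tau>. W \<tau> * cpow t (u \<tau>) \<partial>lborel))"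
    using lborel_pair.integrable_fst'[OF int] by (simp add: inner)
  have "(\<integral>t. F t \<tau> \<partial>lborel) = W \<tau> * (\<integral>t. K t * cpow t (u \<tau>) \<partial>lborel)" for \<tau>
    by (subst integral_mult_right_zero[symmetric]) (simp add: F_def mult_ac)
  then show "(\<integral>t. K t * (\<integral>\<tau>. W \<tau> * cpow t (u \<tau>) \<partial>lborel) \<partial>lborel) = (\<integral>\<tau>. W \<tau> * (\<integral>t. K t * cpow t (u \<tau>) \<partial>lborel) \<partial>lborel)"
    using lborel_pair.Fubini_integral[OF int] by (simp add: inner)
qed

text \<open>A \<open>j\<close>-fold primitive of the superposition of the powers \<open>x\<^bsup>s(\<tau>)-1\<^esup>\<close> with weight \<open>V\<close>: integrating
  \<open>x\<^bsup>s-1\<^esup>\<close> from \<open>0\<close> repeatedly produces \<open>x\<^bsup>s+j-1\<^esup>\<close> divided by the rising factorial \<open>(s)\<^sub>j\<close>.\<close>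

definition Mellin_primitive :: "(real \<Rightarrow> complex) \<Rightarrow> (real \<Rightarrow> complex) \<Rightarrow> nat \<Rightarrow> real \<Rightarrow> complex" where
  "Mellin_primitive V s j x = (\<integral>\<tau>. V \<tau> / pochhammer (s \<tau>) j * cpow x (s \<tau> + of_nat j - 1) \<partial>lborel)"

lemma pochhammer_measurable [measurable]:
  fixes f :: "'a \<Rightarrow> complex"
  assumes [measurable]: "f \<in> borel_measurable M"
  shows "(\<lambda>x. pochhammer (f x) k) \<in> borel_measurable M"
  by (induction k) (simp_all add: pochhammer_Suc)

text \<open>On a line \<open>Re s = r > 0\<close> the rising factorials are bounded below by \<open>(r)\<^sub>j > 0\<close>, so a multiple of
  \<open>|V|\<close> dominates the derivative of the integrand locally uniformly in \<open>x\<close>.\<close>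

lemma Mellin_primitive_deriv:
  assumes V: "integrable lborel V" and s[measurable]: "s \<in> borel_measurable borel"
    and re: "\<And>\<tau>. Re (s \<tau>) = r" and r: "r > 0" and x: "x > 0"
  shows "(Mellin_primitive V s (Suc j) has_vector_derivative Mellin_primitive V s j x) (at x)"
proof -
  have [measurable]: "V \<in> borel_measurable borel" using V by auto
  have poch: "pochhammer r k \<le> norm (pochhammer (s \<tau>) k)" "pochhammer r k > 0" for k \<tau>
    using r re by (auto intro!: norm_pochhammer_mono pochhammer_pos)
  have bnd: "norm (V \<tau> / pochhammer (s \<tau>) k * cpow y (s \<tau> + of_nat k - 1)) \<le> norm (V \<tau>) / pochhammer r k * y powr (r + real k - 1)"
    if "y > 0" for y \<tau> k
    using poch(1)[of k \<tau>] poch(2)[of k] that re[of \<tau>] unfolding norm_mult norm_divide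
    by (intro mult_mono divide_left_mono) (auto simp: norm_cpow intro!: mult_pos_pos elim: order.strict_trans2)
  have int: "integrable lborel (\<lambda>\<tau>. V \<tau> / pochhammer (s \<tau>) k * cpow y (s \<tau> + of_nat k - 1))" if "y > 0" for y k
  proof (rule Bochner_Integration.integrable_bound)
    show "integrable lborel (\<lambda>\<tau>. norm (V \<tau>) / pochhammer r k * y powr (r + real k - 1))"
      using V by (intro integrable_mult_left integrable_divide integrable_norm)
    show "AE \<tau> in lborel. norm (V \<tau> / pochhammer (s \<tau>) k * cpow y (s \<tau> + of_nat k - 1)) \<le> norm (norm (V \<tau>) / pochhammer r k * y powr (r + real k - 1))"
      by (intro AE_I2) (simp only: real_norm_def order.trans[OF bnd[OF that] abs_ge_self])
  qed measurable
  (* Near x the power is bounded by its values at the two ends of the interval. *)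
  define e where "e = r + real j - 1"
  define C where "C = (x / 2) powr e + (2 * x) powr e"
  have C: "y powr e \<le> C" if "x / 2 < y" "y < 2 * x" for y
  proof (cases "e \<ge> 0")
    case True
    then have "y powr e \<le> (2 * x) powr e" using that x by (intro powr_mono2) auto
    then show ?thesis by (simp add: C_def add_increasing)
  next
    case False
    then have "y powr e \<le> (x / 2) powr e" using that x by (intro powr_mono2') auto
    then show ?thesis by (simp add: C_def add_increasing2)
  qed
  show ?thesis
    unfolding Mellin_primitive_def[abs_def]
  proof (rule has_vector_derivative_integral[where a = "x / 2" and b = "2 * x" and g = "\<lambda>\<tau>. norm (V \<tau>) / pochhammer r j * C"])
    show "integrable lborel (\<lambda>\<tau>. V \<tau> / pochhammer (s \<tau>) (Suc j) * cpow y (s \<tau> + of_nat (Suc j) - 1))" if "x / 2 < y" "y < 2 * x" for y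
      using that x by (intro int) auto
    show "((\<lambda>y. V \<tau> / pochhammer (s \<tau>) (Suc j) * cpow y (s \<tau> + of_nat (Suc j) - 1)) has_vector_derivative
        V \<tau> / pochhammer (s \<tau>) j * cpow y (s \<tau> + of_nat j - 1)) (at y)" if "x / 2 < y" "y < 2 * x" for y \<tau>
    proof -
      have y: "y > 0" using that x by auto
      have "Re (s \<tau> + of_nat j) > 0" using re r by simp
      then have nz: "s \<tau> + of_nat j \<noteq> 0" by (metis less_irrefl zero_complex.sel(1))
      have nz': "pochhammer (s \<tau>) j \<noteq> 0" using poch(1)[of j \<tau>] poch(2)[of j] by auto
      have "((\<lambda>y. V \<tau> / pochhammer (s \<tau>) (Suc j) * cpow y (s \<tau> + of_nat j)) has_vector_derivative
         V \<tau> / pochhammer (s \<tau>) (Suc j) * ((s \<tau> + of_nat j) * cpow y (s \<tau> + of_nat j - 1))) (at y)"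
        by (intro has_vector_derivative_mult_right has_vector_derivative_cpow y)
      moreover have "V \<tau> / pochhammer (s \<tau>) (Suc j) * ((s \<tau> + of_nat j) * cpow y (s \<tau> + of_nat j - 1)) = V \<tau> / pochhammer (s \<tau>) j * cpow y (s \<tau> + of_nat j - 1)"
        using nz nz' by (simp add: pochhammer_Suc)
      moreover have "s \<tau> + of_nat (Suc j) - 1 = s \<tau> + of_nat j" by simp
      ultimately show ?thesis by simp
    qed
    show "norm (V \<tau> / pochhammer (s \<tau>) j * cpow y (s \<tau> + of_nat j - 1)) \<le> norm (V \<tau>) / pochhammer r j * C" if "x / 2 < y" "y < 2 * x" for y \<tau>
    proof -
      have "norm (V \<tau> / pochhammer (s \<tau>) j * cpow y (s \<tau> + of_nat j - 1)) \<le> norm (V \<tau>) / pochhammer r j * y powr e"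
        using bnd[of y \<tau> j] that x by (simp add: e_def)
      also have "\<dots> \<le> norm (V \<tau>) / pochhammer r j * C"
        using C[OF that] poch(2)[of j] by (intro mult_left_mono) auto
      finally show ?thesis .
    qed
    show "integrable lborel (\<lambda>\<tau>. norm (V \<tau>) / pochhammer r j * C)"
      using V by (intro integrable_mult_left integrable_divide integrable_norm)
  qed (use x in auto)
qed

lemma vderiv_Mellin_primitive:
  assumes V: "integrable lborel V" and s: "s \<in> borel_measurable borel"
    and re: "\<And>\<tau>. Re (s \<tau>) = r" and r: "r > 0"
    and g: "\<And>x. x > 0 \<Longrightarrow> g x = Mellin_primitive V s N x" and k: "k \<le> N"
  shows "\<forall>x>0. (vderiv ^^ k) g x = Mellin_primitive V s (N - k) x"
    and "k < N \<Longrightarrow> \<forall>x>0. (vderiv ^^ k) g differentiable (at x)"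
proof -
  have deriv: "((vderiv ^^ k) g has_vector_derivative Mellin_primitive V s (N - Suc k) x) (at x)"
    if "\<forall>x>0. (vderiv ^^ k) g x = Mellin_primitive V s (N - k) x" "k < N" "x > 0" for k x
  proof (rule has_vector_derivative_transform_within_open[where S = "{0<..}"])
    have "N - k = Suc (N - Suc k)" using that(2) by simp
    then show "(Mellin_primitive V s (N - k) has_vector_derivative Mellin_primitive V s (N - Suc k) x) (at x)"
      using Mellin_primitive_deriv[OF V s re r that(3)] by simp
  qed (use that in auto)
  have main: "\<forall>x>0. (vderiv ^^ k) g x = Mellin_primitive V s (N - k) x" if "k \<le> N" for k
    using that
  proof (induction k)
    case (Suc k)
    have "vderiv h x = v" if "(h has_vector_derivative v) (at x)" for h x v
      using that by (simp add: vderiv_def vector_derivative_at)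
    with Suc show ?case using deriv[of k] by simp
  qed (use g in auto)
  show "\<forall>x>0. (vderiv ^^ k) g x = Mellin_primitive V s (N - k) x" using main k .
  show "\<forall>x>0. (vderiv ^^ k) g differentiable (at x)" if "k < N"
    using deriv[OF main[OF k] that] by (auto intro: differentiableI_vector)
qed

section \<open>The Erdelyi-Kober derivative of the I-function\<close>

text \<open>The argument \<open>\<theta>\<close> of \<open>a t\<^sup>\<mu>\<close> is the one of \<open>a\<close>, so only \<open>ln |a t\<^sup>\<mu>| = ln |a| + \<mu> ln t\<close> depends on \<open>t\<close>, and
  the dependence splits off as a power of \<open>t\<close>.\<close>

lemma I_fun_Mellin:
  assumes "a \<noteq> 0" "t > 0"
  shows "I_fun L m n up lo \<theta> (a * of_real (t powr \<mu>)) = 1 / (2 * of_real pi) *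
    (\<integral>\<tau>. (I_chi L m n up lo (\<i> * of_real \<tau>) * exp (- (\<i> * of_real \<tau>) * (of_real (ln (norm a)) + \<i> * of_real \<theta>)))
        * cpow t (- (\<i> * of_real (\<mu> * \<tau>))) \<partial>lborel)"
proof -
  have "ln (norm (a * of_real (t powr \<mu>))) = ln (norm a) + \<mu> * ln t"
    using assms by (simp add: norm_mult ln_mult ln_powr)
  then have e: "exp (- (\<i> * of_real \<tau>) * (of_real (ln (norm (a * of_real (t powr \<mu>)))) + \<i> * of_real \<theta>)) =
     exp (- (\<i> * of_real \<tau>) * (of_real (ln (norm a)) + \<i> * of_real \<theta>)) * cpow t (- (\<i> * of_real (\<mu> * \<tau>)))" for \<tau>
    by (simp add: cpow_def algebra_simps flip: exp_add)
  show ?thesis unfolding I_fun_def e by (simp add: mult.assoc[symmetric])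
qed

lemma Gamma_pow_1:
  assumes "Gamma_log_branches L"
  shows "Gamma_pow L c d 1 (\<i> * of_real \<tau>) = Gamma (c + of_real d * (\<i> * of_real \<tau>))"
proof -
  have "\<i> * of_real \<tau> \<in> I_contour" by (simp add: I_contour_def)
  then show ?thesis using assms by (auto simp: Gamma_pow_def Gamma_log_branches_def Gamma_eq_zero_iff)
qed

text \<open>For \<open>\<kappa> = 1\<close> every branch of \<open>\<Gamma>\<^sup>\<kappa>\<close> is \<open>\<Gamma>\<close> itself.\<close>

lemma I_chi_extend:
  assumes "Gamma_log_branches L" "m \<le> length lo"
  shows "I_chi L m (n + 1) ((c, \<mu>, 1) # up) (lo @ [(d, \<mu>, 1)]) (\<i> * of_real \<tau>) =
    I_chi L m n up lo (\<i> * of_real \<tau>) * Gamma (1 - c - \<i> * of_real (\<mu> * \<tau>)) * rGamma (1 - d - \<i> * of_real (\<mu> * \<tau>))"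
  using assms Gamma_pow_1[OF assms(1), of "1 - _" "- \<mu>" \<tau>]
  by (simp add: I_chi_def rGamma_inverse_Gamma divide_inverse mult_ac)

text \<open>The inner integral of the derivative, applied to a superposition of powers. Its parameters are
  chosen so that the Gamma quotient of \<open>saigo_kernel_power\<close> is
  \<open>\<Gamma>(A) \<Gamma>(s) \<Gamma>(s+\<alpha>+\<gamma>) / (\<Gamma>(s+N) \<Gamma>(s+\<gamma>))\<close>, where \<open>\<Gamma>(s) / \<Gamma>(s+N) = 1 / (s)\<^sub>N\<close> turns the result into an
  \<open>N\<close>-fold primitive.\<close>

lemma saigo_integral_Mellin:
  fixes V W s :: "real \<Rightarrow> complex" and N :: nat
  assumes W: "integrable lborel W" and s[measurable]: "s \<in> borel_measurable borel"
    and re: "\<And>\<tau>. Re (s \<tau>) = Re \<rho>" and \<rho>: "Re \<rho> > 0" "Re (\<rho> + \<alpha> + \<gamma>) > 0"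
    and N: "Re \<alpha> < N"
    and V: "\<And>\<tau>. V \<tau> = W \<tau> * Gamma (s \<tau> + \<alpha> + \<gamma>) * rGamma (s \<tau> + \<gamma>)"
    and f: "\<And>t. t > 0 \<Longrightarrow> f t = cpow t (\<rho> - 1) * (\<integral>\<tau>. W \<tau> * cpow t (s \<tau> - \<rho>) \<partial>lborel)"
    and x: "x > 0"
  defines "A \<equiv> - \<alpha> + of_nat N" and "B \<equiv> - of_nat N" and "C \<equiv> \<alpha> + \<gamma> - of_nat N"
  shows "set_integrable lborel {0<..<x} (saigo_integrand A B C f x)"
    and "saigo_integral A B C f x = Mellin_primitive V s N x"
proof -
  have A: "Re A > 0" using N by (simp add: A_def)
  have AB: "A + B = - \<alpha>" by (simp add: A_def B_def)
  define K where "K t = saigo_kernel (A + B) (- C) A x t * cpow t (\<rho> - 1)" for t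
  have K: "integrable lborel K" unfolding K_def
    using A \<rho> x by (intro saigo_kernel_power) (auto simp: A_def B_def C_def)
  have integrand: "indicator {0<..<x} t *\<^sub>R saigo_integrand A B C f x t = K t * (\<integral>\<tau>. W \<tau> * cpow t (s \<tau> - \<rho>) \<partial>lborel)" for t
    using cpow_eq_powr[of "x - t" "A - 1"]
    by (auto simp: indicator_def saigo_integrand_def saigo_kernel_def K_def f)
  have s': "(\<lambda>\<tau>. s \<tau> - \<rho>) \<in> borel_measurable borel" by measurable
  note Fub = Fubini_Mellin[OF K W s']
  show "set_integrable lborel {0<..<x} (saigo_integrand A B C f x)"
    unfolding set_integrable_def integrand using re by (intro Fub(1)) simp
  have KI: "(\<integral>t. K t * cpow t (s \<tau> - \<rho>) \<partial>lborel) =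
    cpow x (A + s \<tau> - 1) * (Gamma A * Gamma (s \<tau>) * Gamma (s \<tau> + \<alpha> + \<gamma>) * rGamma (s \<tau> + of_nat N) * rGamma (s \<tau> + \<gamma>))" for \<tau>
  proof -
    have "K t * cpow t (s \<tau> - \<rho>) = saigo_kernel (A + B) (- C) A x t * cpow t (s \<tau> - 1)" for t
      using cpow_add[of t "\<rho> - 1" "s \<tau> - \<rho>"] by (simp add: K_def)
    moreover have e: "s \<tau> + A - (A + B) - (- C) = s \<tau> + \<alpha> + \<gamma>" "s \<tau> + A - (A + B) = s \<tau> + of_nat N" "s \<tau> + A - (- C) = s \<tau> + \<gamma>"
      by (simp_all add: A_def B_def C_def)
    have "Re (s \<tau>) > 0" "Re (s \<tau> + A - (A + B) - (- C)) > 0"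
      using re[of \<tau>] \<rho> by (simp, simp only: e(1)) simp
    note saigo_kernel_power(2)[OF x A this, unfolded e(1), unfolded e(2,3)]
    ultimately show ?thesis by (simp only:)
  qed
  have "saigo_integral A B C f x = of_real x powr (- A - B) / Gamma A * (\<integral>t. K t * (\<integral>\<tau>. W \<tau> * cpow t (s \<tau> - \<rho>) \<partial>lborel) \<partial>lborel)"
    by (simp add: saigo_integral_def set_lebesgue_integral_def integrand)
  also have "of_real x powr (- A - B) = cpow x \<alpha>"
    using cpow_eq_powr[OF x] by (simp add: A_def B_def)
  also have "(\<integral>t. K t * (\<integral>\<tau>. W \<tau> * cpow t (s \<tau> - \<rho>) \<partial>lborel) \<partial>lborel) = (\<integral>\<tau>. W \<tau> * (\<integral>t. K t * cpow t (s \<tau> - \<rho>) \<partial>lborel) \<partial>lborel)"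
    using re by (intro Fub(2)) simp
  also have "cpow x \<alpha> / Gamma A * \<dots> = (\<integral>\<tau>. cpow x \<alpha> / Gamma A * (W \<tau> * (\<integral>t. K t * cpow t (s \<tau> - \<rho>) \<partial>lborel)) \<partial>lborel)"
    by simp
  also have "\<dots> = Mellin_primitive V s N x"
    unfolding Mellin_primitive_def
  proof (rule Bochner_Integration.integral_cong[OF refl])
    fix \<tau>
    have sn: "s \<tau> \<notin> \<int>\<^sub>\<le>\<^sub>0" using re[of \<tau>] \<rho> by (intro Re_pos_notin_nonpos_Ints) simp
    have p: "Gamma (s \<tau>) * rGamma (s \<tau> + of_nat N) = 1 / pochhammer (s \<tau>) N"
    proof -
      have "Gamma (s \<tau> + of_nat N) = Gamma (s \<tau>) * pochhammer (s \<tau>) N"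
        using pochhammer_Gamma[OF sn, of N] sn by (simp add: Gamma_eq_zero_iff)
      then show ?thesis using sn by (simp add: rGamma_inverse_Gamma Gamma_eq_zero_iff divide_simps)
    qed
    have GA: "Gamma A \<noteq> 0" using Re_pos_notin_nonpos_Ints[OF A] by (simp add: Gamma_eq_zero_iff)
    have cx: "cpow x \<alpha> * cpow x (A + s \<tau> - 1) = cpow x (s \<tau> + of_nat N - 1)"
      by (simp add: A_def algebra_simps flip: cpow_add)
    have "cpow x \<alpha> / Gamma A * (W \<tau> * (\<integral>t. K t * cpow t (s \<tau> - \<rho>) \<partial>lborel)) =
       (W \<tau> * Gamma (s \<tau> + \<alpha> + \<gamma>) * rGamma (s \<tau> + \<gamma>)) * (Gamma (s \<tau>) * rGamma (s \<tau> + of_nat N)) * (cpow x \<alpha> * cpow x (A + s \<tau> - 1))"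
      using GA unfolding KI by simp
    then show "cpow x \<alpha> / Gamma A * (W \<tau> * (\<integral>t. K t * cpow t (s \<tau> - \<rho>) \<partial>lborel)) = V \<tau> / pochhammer (s \<tau>) N * cpow x (s \<tau> + of_nat N - 1)"
      unfolding p cx V by simp
  qed
  finally show "saigo_integral A B C f x = Mellin_primitive V s N x" .
qed

theorem corollary4p2:
  fixes m n p q :: nat
    and up lo :: "(complex \<times> real \<times> real) list"
    and L :: "complex \<Rightarrow> real \<Rightarrow> real \<Rightarrow> complex \<Rightarrow> complex"
    and \<alpha> \<gamma> \<rho> a :: complex
    and \<mu> \<theta> :: real
    and f :: "real \<Rightarrow> complex"
  assumes "length up = p" and "length lo = q" and "m \<le> q" and "n \<le> p"
    and "\<forall>(a\<^sub>i, A\<^sub>i, \<alpha>\<^sub>i) \<in> set up. A\<^sub>i > 0 \<and> \<alpha>\<^sub>i > 0"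
    and "\<forall>(b\<^sub>j, B\<^sub>j, \<beta>\<^sub>j) \<in> set lo. B\<^sub>j > 0 \<and> \<beta>\<^sub>j > 0"
    and "Gamma_log_branches L"
    and "Re \<alpha> > 0" and "a \<noteq> 0" and "is_Arg a \<theta>"
    and "\<mu> > 0" and "Re \<rho> > max 0 (Re (- \<alpha> - \<gamma>))"
    and "I_separated m n up lo" and "I_convergent m n up lo \<theta>"
    and "I_separated m (n + 1) ((1 - \<alpha> - \<gamma> - \<rho>, \<mu>, 1) # up) (lo @ [(1 - \<gamma> - \<rho>, \<mu>, 1)])"
    and "I_convergent m (n + 1) ((1 - \<alpha> - \<gamma> - \<rho>, \<mu>, 1) # up) (lo @ [(1 - \<gamma> - \<rho>, \<mu>, 1)]) \<theta>"
    and f_def: "f = (\<lambda>t. of_real t powr (\<rho> - 1) * I_fun L m n up lo \<theta> (a * of_real (t powr \<mu>)))"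
  shows "saigo_derivative_exists \<alpha> 0 \<gamma> f \<and>
    (\<forall>x>0. erdelyi_kober_derivative \<gamma> \<alpha> f x =
      of_real x powr (\<rho> - 1) *
      I_fun L m (n + 1) ((1 - \<alpha> - \<gamma> - \<rho>, \<mu>, 1) # up) (lo @ [(1 - \<gamma> - \<rho>, \<mu>, 1)]) \<theta>
        (a * of_real (x powr \<mu>)))"
proof -
  note up = assms(5) and lo = assms(6) and L = assms(7)
  define up' where "up' = (1 - \<alpha> - \<gamma> - \<rho>, \<mu>, 1::real) # up"
  define lo' where "lo' = lo @ [(1 - \<gamma> - \<rho>, \<mu>, 1::real)]"
  have up': "\<forall>(c, d, \<kappa>) \<in> set up'. d > 0 \<and> \<kappa> > 0" and lo': "\<forall>(c, d, \<kappa>) \<in> set lo'. d > 0 \<and> \<kappa> > 0"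
    using up lo assms(11) by (auto simp: up'_def lo'_def)
  define E where "E \<tau> = exp (- (\<i> * of_real \<tau>) * (of_real (ln (norm a)) + \<i> * of_real \<theta>))" for \<tau> :: real
  define W where "W \<tau> = 1 / (2 * of_real pi) * (I_chi L m n up lo (\<i> * of_real \<tau>) * E \<tau>)" for \<tau> :: real
  define V where "V \<tau> = 1 / (2 * of_real pi) * (I_chi L m (n + 1) up' lo' (\<i> * of_real \<tau>) * E \<tau>)" for \<tau> :: real
  define s where "s \<tau> = \<rho> - \<i> * of_real (\<mu> * \<tau>)" for \<tau> :: real
  define N where "N = saigo_order \<alpha>"
  have intW: "integrable lborel W" unfolding W_def E_def
    using I_integrand_integrable[OF L up lo assms(13,14)] by (intro integrable_mult_right)
  have intV: "integrable lborel V" unfolding V_def E_def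
    using I_integrand_integrable[OF L up' lo', of m "n + 1" \<theta>] assms(15,16) by (intro integrable_mult_right) (simp_all add: up'_def lo'_def)
  have N: "Re \<alpha> < N" using assms(8) unfolding N_def saigo_order_def by linarith
  have s_meas: "s \<in> borel_measurable borel" unfolding s_def by measurable
  have re: "Re (s \<tau>) = Re \<rho>" for \<tau> by (simp add: s_def)
  have \<rho>: "Re \<rho> > 0" "Re (\<rho> + \<alpha> + \<gamma>) > 0" using assms(12) by auto
  have VW: "V \<tau> = W \<tau> * Gamma (s \<tau> + \<alpha> + \<gamma>) * rGamma (s \<tau> + \<gamma>)" for \<tau>
    using I_chi_extend[OF L, of m lo n "1 - \<alpha> - \<gamma> - \<rho>" \<mu> up "1 - \<gamma> - \<rho>" \<tau>] assms(2,3)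
    by (simp add: V_def W_def up'_def lo'_def s_def algebra_simps)
  have f: "f t = cpow t (\<rho> - 1) * (\<integral>\<tau>. W \<tau> * cpow t (s \<tau> - \<rho>) \<partial>lborel)" if "t > 0" for t
    using that unfolding f_def I_fun_Mellin[OF assms(9) that] W_def E_def
    by (simp add: cpow_eq_powr s_def mult.assoc)
  note saigo = saigo_integral_Mellin[OF intW s_meas re \<rho> N VW f]
  define g where "g = saigo_integral (- \<alpha> + of_nat N) (- of_nat N) (\<alpha> + \<gamma> - of_nat N) f"
  have g: "g x = Mellin_primitive V s N x" if "x > 0" for x
    unfolding g_def using saigo(2) that by simp
  note vd = vderiv_Mellin_primitive[OF intV s_meas re \<rho>(1) g]
  have ex: "saigo_derivative_exists \<alpha> 0 \<gamma> f"
    using saigo(1) vd(2) by (auto simp: saigo_derivative_exists_def Let_def N_def[symmetric] g_def)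
  have "erdelyi_kober_derivative \<gamma> \<alpha> f x = of_real x powr (\<rho> - 1) * I_fun L m (n + 1) up' lo' \<theta> (a * of_real (x powr \<mu>))"
    if "x > 0" for x
  proof -
    have "erdelyi_kober_derivative \<gamma> \<alpha> f x = (vderiv ^^ N) g x"
      by (simp add: erdelyi_kober_derivative_def saigo_derivative_def Let_def N_def[symmetric] g_def)
    also have "\<dots> = Mellin_primitive V s 0 x" using vd(1)[of N] that by simp
    also have "\<dots> = (\<integral>\<tau>. cpow x (\<rho> - 1) * (V \<tau> * cpow x (- (\<i> * of_real (\<mu> * \<tau>)))) \<partial>lborel)"
      unfolding Mellin_primitive_def
    proof (rule Bochner_Integration.integral_cong[OF refl])
      fix \<tau>
      have "s \<tau> + of_nat 0 - 1 = (\<rho> - 1) + (- (\<i> * of_real (\<mu> * \<tau>)))" by (simp add: s_def)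
      then show "V \<tau> / pochhammer (s \<tau>) 0 * cpow x (s \<tau> + of_nat 0 - 1) = cpow x (\<rho> - 1) * (V \<tau> * cpow x (- (\<i> * of_real (\<mu> * \<tau>))))"
        by (simp only: cpow_add pochhammer_0 div_by_1 mult_ac)
    qed
    also have "\<dots> = cpow x (\<rho> - 1) * (\<integral>\<tau>. V \<tau> * cpow x (- (\<i> * of_real (\<mu> * \<tau>))) \<partial>lborel)" by simp
    also have "(\<integral>\<tau>. V \<tau> * cpow x (- (\<i> * of_real (\<mu> * \<tau>))) \<partial>lborel) = I_fun L m (n + 1) up' lo' \<theta> (a * of_real (x powr \<mu>))"
      unfolding I_fun_Mellin[OF assms(9) that] V_def E_def by (simp add: mult.assoc)
    finally show ?thesis using that by (simp add: cpow_eq_powr)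
  qed
  with ex show ?thesis by (simp add: up'_def lo'_def)
qed

end
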